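(* Let $\Delta$ be a homogeneous simplicial complex of dimension $d-2$ with vertex set $\{u_1,\dots,u_m\}$ and facets given by the square-free monomials $g_1,\dots,g_n\in\mathbb{K}[u_1,\dots,u_m]_{d-1}$. Let $f=f_\Delta=\sum_{i=1}^n x_ig_i$, let $I=\operatorname{Ann}_Q(f)$, and let $A=A_\Delta=Q/I$ be the associated algebra. Let $e_k$ be the number of $(k-1)$-faces of $\Delta$. Then: (1) $A=\bigoplus_{k=0}^d A_k$, where $A_k=A_{(0,k)}\oplus A_{(1,k-1)}$. (2) $A_{(0,k)}$ has a basis identified with the $(k-1)$-faces of $\Delta$ (namely the classes of the monomials in $U_1,\dots,U_m$ dual to the $(k-1)$-faces); hence $\dim A_{(0,k)}=e_k$. (3) By duality, $A_{(1,k-1)}^*\simeq A_{(0,d-k)}$, and a basis for $A_{(1,k-1)}$ can be chosen by taking, for each $(d-k-1)$-face of $\Delta$, a monomial $X_i\tilde G_i$ (with $\tilde G_i$ a monomial in $U_1,\dots,U_m$) such that $X_i\tilde G_i(f)$ represents that face. (4) The Hilbert vector of $A$ is given by $h_k=\dim A_k=e_k+e_{d-k}$. (5) The ideal $I$ is generated by the following elements: (a) $(X_1,\dots,X_n)^2$ and $U_1^2,\dots,U_m^2$; (b) the monomials in $I$ representing minimal non-faces of $\Delta$; (c) the monomials $X_iF_i$, where $F_i$ is a monomial in $U_1,\dots,U_m$ whose dual monomial $f_i\in\mathbb{K}[u_1,\dots,u_m]$ does not represent a subface of $g_i$; (d) the binomials $X_i\tilde G_i-X_j\tilde G_j$, where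 $g_i=\tilde g_ig_{ij}$, $g_j=\tilde g_jg_{ij}$, the monomial $g_{ij}$ represents a common subface of $g_i$ and $g_j$, and $\tilde G_i,\tilde G_j$ are the operators dual to $\tilde g_i,\tilde g_j$.
   Context: $\mathbb{K}$ is a field of characteristic $0$. A simplicial complex $\Delta$ on a finite vertex set $V=\{u_1,\dots,u_m\}$ is a collection of subsets of $V$ (faces) closed under taking subsets. A face with $k$ elements is a $(k-1)$-face (dimension $k-1$). Facets are the maximal faces. $\Delta$ is homogeneous of dimension $d-2$ if all facets have dimension $d-2$, i.e. $d-1$ elements. Every $u_i$ is a vertex (0-face) of $\Delta$. A subset $F\subseteq V$ is identified with the square-free monomial $m_F=\prod_{u_i\in F}u_i$; the empty face corresponds to the monomial $1$. A subface of a facet is a subset of it. Let $R=\mathbb{K}[x_1,\dots,x_n,u_1,\dots,u_m]$ and $Q=\mathbb{K}[X_1,\dots,X_n,U_1,\dots,U_m]$, where $Q$ acts on $R$ by $X_i=\partial/\partial x_i$, $U_j=\partial/\partial u_j$; for $p\in Q$ and $f\in R$, $p(f)$ denotes the result of this action, and $\operatorname{Ann}_Q(f)=\{p\in Q: p(f)=0\}$. Both rings are bigraded, with $x_i,X_i$ in bidegree $(1,0)$ and $u_j,U_j$ in bidegree $(0,1)$. Since $f_\Delta$ is bihomogeneous of bidegree $(1,d-1)$, $I$ is bihomogeneous and $A=Q/I$ is bigraded, with bigraded pieces $A_{(i,j)}$ and total-degree pieces $A_k$ ($A_{(1,-1)}=0$). One assumes $I_1=0$. For a monomial $p\in\mathbb{K}[u_1,\dots,u_m]$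 its dual operator is the capital-letter monomial $P=p(U_1,\dots,U_m)$; faces of $\Delta$ are thus also identified with monomials in the $U_j$. Conventions for face numbers: $e_0=1$, $e_1=m$, $e_{d-1}=n$, and $e_j=0$ for $j\ge d$. *)

theory Defs
  imports
    "HOL-Library.Poly_Mapping"
    "HOL-Algebra.QuotRing"
    "Jordan_Normal_Form.VS_Connect"
begin

definition simplicial_complex :: "'v set \<Rightarrow> 'v set set \<Rightarrow> bool" where
  "simplicial_complex V D \<longleftrightarrow> finite V \<and> D \<subseteq> Pow V \<and> (\<forall>F\<in>D. \<forall>G. G \<subseteq> F \<longrightarrow> G \<in> D)"

definition face_dim :: "'v set \<Rightarrow> int" where
  "face_dim F = int (card F) - 1"

definition faces_of_dim :: "'v set set \<Rightarrow> int \<Rightarrow> 'v set set" where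
  "faces_of_dim D k = {F \<in> D. face_dim F = k}"

definition facets :: "'v set set \<Rightarrow> 'v set set" where
  "facets D = {F \<in> D. \<forall>G\<in>D. F \<subseteq> G \<longrightarrow> G = F}"

definition homogeneous_complex :: "'v set set \<Rightarrow> int \<Rightarrow> bool" where
  "homogeneous_complex D k \<longleftrightarrow> (\<forall>F\<in>facets D. face_dim F = k)"

definition minimal_nonface :: "'v set \<Rightarrow> 'v set set \<Rightarrow> 'v set \<Rightarrow> bool" where
  "minimal_nonface V D F \<longleftrightarrow> F \<subseteq> V \<and> F \<notin> D \<and> (\<forall>G. G \<subset> F \<longrightarrow> G \<in> D)"

definition face_number :: "'v set set \<Rightarrow> nat \<Rightarrow> nat" where
  "face_number D k = card (faces_of_dim D (int k - 1))"

text \<open>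
  The rings \<open>R = K[x_1,...,x_n,u_1,...,u_m]\<close> and \<open>Q = K[X_1,...,X_n,U_1,...,U_m]\<close> are
  represented by one and the same ring, so that passing from a monomial to its dual operator is
  the identity. Whether an element is read in \<open>R\<close> or in \<open>Q\<close> is determined by its role: the first
  argument of \<open>act\<close> below is a differential operator, the second one a polynomial.
\<close>

datatype var = Xvar nat | Uvar nat

type_synonym 'k mpoly = "(var \<Rightarrow>\<^sub>0 nat) \<Rightarrow>\<^sub>0 'k"

definition const :: "'k::zero \<Rightarrow> 'k mpoly" where
  "const c = Poly_Mapping.single 0 c"

definition varX :: "nat \<Rightarrow> 'k::zero_neq_one mpoly" where
  "varX i = Poly_Mapping.single (Poly_Mapping.single (Xvar i) 1) 1"

definition varU :: "nat \<Rightarrow> 'k::zero_neq_one mpoly" where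
  "varU j = Poly_Mapping.single (Poly_Mapping.single (Uvar j) 1) 1"

definition poly_ring :: "nat \<Rightarrow> nat \<Rightarrow> 'k::field mpoly ring" where
  "poly_ring n m =
    \<lparr>carrier = {p. \<forall>\<alpha>\<in>Poly_Mapping.keys p. Poly_Mapping.keys \<alpha> \<subseteq> Xvar ` {1..n} \<union> Uvar ` {1..m}},
     mult = (*), one = 1, zero = 0, add = (+)\<rparr>"

definition face_monomial :: "nat set \<Rightarrow> 'k::field mpoly" where
  "face_monomial F = (\<Prod>j\<in>F. varU j)"

definition U_monomials :: "nat \<Rightarrow> 'k::field mpoly set" where
  "U_monomials m = {(\<Prod>j\<in>{1..m}. varU j ^ a j) |a. True}"

definition X_degree :: "(var \<Rightarrow>\<^sub>0 nat) \<Rightarrow> nat" where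
  "X_degree \<alpha> = (\<Sum>v\<in>Poly_Mapping.keys \<alpha>. case v of Xvar i \<Rightarrow> Poly_Mapping.lookup \<alpha> v | Uvar j \<Rightarrow> 0)"

definition U_degree :: "(var \<Rightarrow>\<^sub>0 nat) \<Rightarrow> nat" where
  "U_degree \<alpha> = (\<Sum>v\<in>Poly_Mapping.keys \<alpha>. case v of Xvar i \<Rightarrow> 0 | Uvar j \<Rightarrow> Poly_Mapping.lookup \<alpha> v)"

text \<open>Degrees are integers, so that the piece of bidegree \<open>(1,-1)\<close> makes sense (it is zero).\<close>

definition bihom_part :: "nat \<Rightarrow> nat \<Rightarrow> int \<Rightarrow> int \<Rightarrow> 'k::field mpoly set" where
  "bihom_part n m i j = {p \<in> carrier (poly_ring n m).
     \<forall>\<alpha>\<in>Poly_Mapping.keys p. int (X_degree \<alpha>) = i \<and> int (U_degree \<alpha>) = j}"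

definition hom_part :: "nat \<Rightarrow> nat \<Rightarrow> int \<Rightarrow> 'k::field mpoly set" where
  "hom_part n m k = {p \<in> carrier (poly_ring n m).
     \<forall>\<alpha>\<in>Poly_Mapping.keys p. int (X_degree \<alpha> + U_degree \<alpha>) = k}"

definition pd :: "var \<Rightarrow> 'k::field mpoly \<Rightarrow> 'k mpoly" where
  "pd v f = (\<Sum>\<alpha>\<in>Poly_Mapping.keys f. Poly_Mapping.single (\<alpha> - Poly_Mapping.single v 1)
                            (of_nat (Poly_Mapping.lookup \<alpha> v) * Poly_Mapping.lookup f \<alpha>))"

text \<open>
  A monomial acts by the composition of the corresponding partial derivatives; the order of
  composition does not matter by \<open>pd_commute\<close>, so the fold is well defined.
\<close>

definition monomial_act :: "(var \<Rightarrow>\<^sub>0 nat) \<Rightarrow> 'k::field mpoly \<Rightarrow> 'k mpoly" where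
  "monomial_act \<alpha> f = Finite_Set.fold (\<lambda>v. pd v ^^ Poly_Mapping.lookup \<alpha> v) f (Poly_Mapping.keys \<alpha>)"

definition act :: "'k::field mpoly \<Rightarrow> 'k mpoly \<Rightarrow> 'k mpoly" where
  "act p f = (\<Sum>\<alpha>\<in>Poly_Mapping.keys p. const (Poly_Mapping.lookup p \<alpha>) * monomial_act \<alpha> f)"

definition Ann :: "nat \<Rightarrow> nat \<Rightarrow> 'k::field mpoly \<Rightarrow> 'k mpoly set" where
  "Ann n m f = {p \<in> carrier (poly_ring n m). act p f = 0}"

definition facet_poly :: "nat \<Rightarrow> (nat \<Rightarrow> nat set) \<Rightarrow> 'k::field mpoly" where
  "facet_poly n g = (\<Sum>i\<in>{1..n}. varX i * face_monomial (g i))"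

definition quot_class :: "nat \<Rightarrow> nat \<Rightarrow> 'k::field mpoly set \<Rightarrow> 'k mpoly \<Rightarrow> 'k mpoly set" where
  "quot_class n m I p = I +>\<^bsub>poly_ring n m\<^esub> p"

definition quot_algebra :: "nat \<Rightarrow> nat \<Rightarrow> 'k::field mpoly set \<Rightarrow> ('k, 'k mpoly set) module" where
  "quot_algebra n m I =
    (let A = poly_ring n m Quot I in
     \<lparr>carrier = carrier A, mult = mult A, one = one A, zero = zero A, add = add A,
      smult = (\<lambda>c a. quot_class n m I (const c) \<otimes>\<^bsub>A\<^esub> a)\<rparr>)"

definition bigraded_piece ::
  "nat \<Rightarrow> nat \<Rightarrow> 'k::field mpoly set \<Rightarrow> int \<Rightarrow> int \<Rightarrow> ('k, 'k mpoly set) module" where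
  "bigraded_piece n m I i j =
    (quot_algebra n m I)\<lparr>carrier := quot_class n m I ` bihom_part n m i j\<rparr>"

definition graded_piece ::
  "nat \<Rightarrow> nat \<Rightarrow> 'k::field mpoly set \<Rightarrow> int \<Rightarrow> ('k, 'k mpoly set) module" where
  "graded_piece n m I k =
    (quot_algebra n m I)\<lparr>carrier := quot_class n m I ` hom_part n m k\<rparr>"

definition internal_direct_sum ::
  "('k, 'a) module \<Rightarrow> 'i set \<Rightarrow> ('i \<Rightarrow> 'a set) \<Rightarrow> bool" where
  "internal_direct_sum V S W \<longleftrightarrow> (\<forall>i\<in>S. W i \<subseteq> carrier V) \<and>
     (\<forall>v\<in>carrier V. \<exists>!c. c \<in> (\<Pi>\<^sub>E i\<in>S. W i) \<and> v = finsum V c S)"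

definition scalar_module :: "('k::field, 'k) module" where
  "scalar_module = \<lparr>carrier = UNIV, mult = (*), one = 1, zero = 0, add = (+), smult = (*)\<rparr>"

text \<open>
  Linear forms are required to be \<open>undefined\<close> outside the carrier, so that forms which agree on
  the carrier are equal. The multiplication of the dual space is an unused record field.
\<close>

definition dual_space :: "('k::field, 'a) module \<Rightarrow> ('k, 'a \<Rightarrow> 'k) module" where
  "dual_space V =
    \<lparr>carrier = LinearCombinations.module_hom class_ring V scalar_module \<inter> extensional (carrier V),
     mult = (\<lambda>_ _. \<lambda>v\<in>carrier V. 0), one = (\<lambda>v\<in>carrier V. 0), zero = (\<lambda>v\<in>carrier V. 0),
     add = (\<lambda>\<phi> \<psi>. \<lambda>v\<in>carrier V. \<phi> v + \<psi> v),
     smult = (\<lambda>c \<phi>. \<lambda>v\<in>carrier V. c * \<phi> v)\<rparr>"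

definition linear_iso :: "('k::field, 'a) module \<Rightarrow> ('k, 'b) module \<Rightarrow> ('a \<Rightarrow> 'b) \<Rightarrow> bool" where
  "linear_iso V W T \<longleftrightarrow> T \<in> LinearCombinations.module_hom class_ring V W \<and> bij_betw T (carrier V) (carrier W)"

definition gens_squares :: "nat \<Rightarrow> nat \<Rightarrow> 'k::field mpoly set" where
  "gens_squares n m = {varX i * varX j |i j. i \<in> {1..n} \<and> j \<in> {1..n}}
                      \<union> {varU j ^ 2 |j. j \<in> {1..m}}"

definition gens_nonfaces :: "nat \<Rightarrow> nat set set \<Rightarrow> 'k::field mpoly set \<Rightarrow> 'k mpoly set" where
  "gens_nonfaces m D I = {face_monomial F |F. minimal_nonface {1..m} D F \<and> face_monomial F \<in> I}"

definition gens_nonsubfaces :: "nat \<Rightarrow> nat \<Rightarrow> (nat \<Rightarrow> nat set) \<Rightarrow> 'k::field mpoly set" where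
  "gens_nonsubfaces n m g = {varX i * P |i P. i \<in> {1..n} \<and> P \<in> U_monomials m
                               \<and> \<not> (\<exists>S. S \<subseteq> g i \<and> P = face_monomial S)}"

definition gens_binomials :: "nat \<Rightarrow> nat \<Rightarrow> (nat \<Rightarrow> nat set) \<Rightarrow> 'k::field mpoly set" where
  "gens_binomials n m g = {varX i * P - varX j * P' |i j P P' S.
      i \<in> {1..n} \<and> j \<in> {1..n} \<and> P \<in> U_monomials m \<and> P' \<in> U_monomials m \<and> S \<subseteq> g i \<inter> g j
      \<and> face_monomial (g i) = P * face_monomial S \<and> face_monomial (g j) = P' * face_monomial S}"

lemma lookup_pd:
  fixes f :: "'k::field mpoly"
  shows "Poly_Mapping.lookup (pd v f) \<beta> =
    of_nat (Suc (Poly_Mapping.lookup \<beta> v)) * Poly_Mapping.lookup f (\<beta> + Poly_Mapping.single v 1)"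
proof -
  let ?e = "Poly_Mapping.single v (1::nat)"
  have key: "(\<alpha> - ?e = \<beta> \<and> Poly_Mapping.lookup \<alpha> v \<noteq> 0) \<longleftrightarrow> \<alpha> = \<beta> + ?e" for \<alpha> :: "var \<Rightarrow>\<^sub>0 nat"
  proof
    assume a: "\<alpha> - ?e = \<beta> \<and> Poly_Mapping.lookup \<alpha> v \<noteq> 0"
    show "\<alpha> = \<beta> + ?e"
    proof (rule poly_mapping_eqI)
      fix w
      from a have "\<beta> = \<alpha> - ?e" by simp
      then have "Poly_Mapping.lookup \<beta> w = Poly_Mapping.lookup \<alpha> w - Poly_Mapping.lookup ?e w"
        by (simp only: lookup_minus)
      with a show "Poly_Mapping.lookup \<alpha> w = Poly_Mapping.lookup (\<beta> + ?e) w"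
        by (cases "w = v") (simp_all add: lookup_add lookup_single)
    qed
  next
    assume "\<alpha> = \<beta> + ?e"
    then show "\<alpha> - ?e = \<beta> \<and> Poly_Mapping.lookup \<alpha> v \<noteq> 0"
      by (simp add: lookup_add)
  qed
  have "Poly_Mapping.lookup (pd v f) \<beta> =
    (\<Sum>\<alpha>\<in>Poly_Mapping.keys f. (of_nat (Poly_Mapping.lookup \<alpha> v) * Poly_Mapping.lookup f \<alpha>) when (\<alpha> - ?e = \<beta>))"
    by (simp add: pd_def lookup_sum lookup_single)
  also have "\<dots> = (\<Sum>\<alpha>\<in>Poly_Mapping.keys f. if \<alpha> = \<beta> + ?e then of_nat (Poly_Mapping.lookup \<alpha> v) * Poly_Mapping.lookup f \<alpha> else 0)"
  proof (rule sum.cong)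
    fix \<alpha> :: "var \<Rightarrow>\<^sub>0 nat"
    show "(of_nat (Poly_Mapping.lookup \<alpha> v) * Poly_Mapping.lookup f \<alpha> when \<alpha> - ?e = \<beta>) =
      (if \<alpha> = \<beta> + ?e then of_nat (Poly_Mapping.lookup \<alpha> v) * Poly_Mapping.lookup f \<alpha> else 0)"
      using key[of \<alpha>] by (cases "\<alpha> - ?e = \<beta>"; cases "Poly_Mapping.lookup \<alpha> v = 0") simp_all
  qed simp
  also have "\<dots> = of_nat (Suc (Poly_Mapping.lookup \<beta> v)) * Poly_Mapping.lookup f (\<beta> + ?e)"
    by (subst sum.delta) (simp_all add: lookup_add in_keys_iff)
  finally show ?thesis .
qed

lemma pd_add: "pd v (f + g) = pd v f + pd v (g :: 'k::field mpoly)"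
  by (rule poly_mapping_eqI) (simp add: lookup_pd lookup_add distrib_left)

lemma lookup_const_mult:
  fixes f :: "'k::field mpoly"
  shows "Poly_Mapping.lookup (const c * f) \<beta> = c * Poly_Mapping.lookup f \<beta>"
  by (simp add: const_def mult_map_scale_conv_mult[symmetric] Poly_Mapping.map.rep_eq when_def)

lemma pd_const_mult: "pd v (const c * f) = const c * pd v (f :: 'k::field mpoly)"
  by (rule poly_mapping_eqI) (simp add: lookup_pd lookup_const_mult)

lemma pd_commute: "pd v (pd w f) = pd w (pd v (f :: 'k::field mpoly))"
  by (rule poly_mapping_eqI)
     (auto simp: lookup_pd lookup_add lookup_single when_def ac_simps)

lemma pd_zero [simp]: "pd v 0 = (0 :: 'k::field mpoly)"
  by (simp add: pd_def)

lemma pd_pow_commute: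
  "(pd v ^^ a) ((pd w ^^ b) f) = (pd w ^^ b) ((pd v ^^ a) (f :: 'k::field mpoly))"
proof -
  have *: "pd v ((pd w ^^ b) f) = (pd w ^^ b) (pd v f)" for f :: "'k mpoly"
    by (induction b) (simp_all, metis pd_commute)
  show ?thesis by (induction a) (simp_all add: *)
qed

interpretation pd_fold: comp_fun_commute "\<lambda>v. pd v ^^ h v :: 'k::field mpoly \<Rightarrow> 'k mpoly" for h
  by unfold_locales (auto simp: fun_eq_iff pd_pow_commute)

lemma monomial_act_superset:
  assumes "finite S" "Poly_Mapping.keys \<alpha> \<subseteq> S"
  shows "monomial_act \<alpha> f = Finite_Set.fold (\<lambda>v. pd v ^^ Poly_Mapping.lookup \<alpha> v) f S"
proof -
  have "Finite_Set.fold (\<lambda>v. pd v ^^ Poly_Mapping.lookup \<alpha> v) f (Poly_Mapping.keys \<alpha> \<union> T)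
          = monomial_act \<alpha> f" if "finite T" "T \<inter> Poly_Mapping.keys \<alpha> = {}" for T
    using that
  proof (induction T)
    case empty
    then show ?case by (simp add: monomial_act_def)
  next
    case (insert v T)
    then have "Poly_Mapping.lookup \<alpha> v = 0" "v \<notin> Poly_Mapping.keys \<alpha> \<union> T"
      by (auto simp: in_keys_iff)
    then show ?case using insert by simp
  qed
  from this[of "S - Poly_Mapping.keys \<alpha>"]
  have "Finite_Set.fold (\<lambda>v. pd v ^^ Poly_Mapping.lookup \<alpha> v) f
          (Poly_Mapping.keys \<alpha> \<union> (S - Poly_Mapping.keys \<alpha>)) = monomial_act \<alpha> f"
    using assms(1) by blast
  moreover have "Poly_Mapping.keys \<alpha> \<union> (S - Poly_Mapping.keys \<alpha>) = S"
    using assms(2) by blast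
  ultimately show ?thesis by simp
qed

lemma monomial_act_add:
  "monomial_act (\<alpha> + \<beta>) f = monomial_act \<alpha> (monomial_act \<beta> (f :: 'k::field mpoly))"
proof -
  let ?S = "Poly_Mapping.keys \<alpha> \<union> Poly_Mapping.keys \<beta>"
  let ?F = "\<lambda>\<gamma> f S. Finite_Set.fold (\<lambda>v. pd v ^^ Poly_Mapping.lookup \<gamma> v) (f :: 'k mpoly) S"
  have comm: "(pd v ^^ a) (?F \<gamma> f S) = ?F \<gamma> ((pd v ^^ a) f) S" if "finite S" for S \<gamma> v a f
    using that
  proof (induction S)
    case empty
    then show ?case by simp
  next
    case (insert w S)
    have "(pd v ^^ a) (?F \<gamma> f (insert w S))
        = (pd v ^^ a) ((pd w ^^ Poly_Mapping.lookup \<gamma> w) (?F \<gamma> f S))"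
      using insert by simp
    also have "\<dots> = (pd w ^^ Poly_Mapping.lookup \<gamma> w) ((pd v ^^ a) (?F \<gamma> f S))"
      by (rule pd_pow_commute)
    also have "\<dots> = ?F \<gamma> ((pd v ^^ a) f) (insert w S)"
      using insert by simp
    finally show ?case .
  qed
  have "?F (\<alpha> + \<beta>) f S = ?F \<alpha> (?F \<beta> f S) S" if "finite S" for S
    using that
  proof (induction S)
    case empty
    then show ?case by simp
  next
    case (insert v S)
    have "?F (\<alpha> + \<beta>) f (insert v S)
        = (pd v ^^ Poly_Mapping.lookup (\<alpha> + \<beta>) v) (?F (\<alpha> + \<beta>) f S)"
      using insert.hyps by (rule pd_fold.fold_insert)
    also have "\<dots> = (pd v ^^ Poly_Mapping.lookup \<alpha> v)
                      ((pd v ^^ Poly_Mapping.lookup \<beta> v) (?F \<alpha> (?F \<beta> f S) S))"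
      unfolding insert.IH by (simp add: lookup_add funpow_add)
    also have "\<dots> = ?F \<alpha> (?F \<beta> f (insert v S)) (insert v S)"
      using insert.hyps by (simp add: comm)
    finally show ?case .
  qed
  from this[of ?S] have "?F (\<alpha> + \<beta>) f ?S = ?F \<alpha> (?F \<beta> f ?S) ?S"
    by (simp only: finite_Un finite_keys simp_thms)
  moreover have "monomial_act (\<alpha> + \<beta>) f = ?F (\<alpha> + \<beta>) f ?S"
    by (rule monomial_act_superset) (simp, rule Poly_Mapping.keys_add)
  moreover have "monomial_act \<alpha> h = ?F \<alpha> h ?S" for h
    by (rule monomial_act_superset) auto
  moreover have "monomial_act \<beta> f = ?F \<beta> f ?S"
    by (rule monomial_act_superset) auto
  ultimately show ?thesis by (simp only:)
qed

lemma pd_pow_linear: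
  "(pd v ^^ a) (f + g) = (pd v ^^ a) f + (pd v ^^ a) (g :: 'k::field mpoly)"
  "(pd v ^^ a) (const c * f) = const c * (pd v ^^ a) (f :: 'k::field mpoly)"
  by (induction a) (auto simp: pd_add pd_const_mult)

lemma monomial_act_linear:
  "monomial_act \<alpha> (f + g) = monomial_act \<alpha> f + monomial_act \<alpha> (g :: 'k::field mpoly)"
  "monomial_act \<alpha> (const c * f) = const c * monomial_act \<alpha> (f :: 'k::field mpoly)"
proof -
  have "Finite_Set.fold (\<lambda>v. pd v ^^ Poly_Mapping.lookup \<alpha> v) (f + g) S =
    Finite_Set.fold (\<lambda>v. pd v ^^ Poly_Mapping.lookup \<alpha> v) f S +
    Finite_Set.fold (\<lambda>v. pd v ^^ Poly_Mapping.lookup \<alpha> v) g S"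
    "Finite_Set.fold (\<lambda>v. pd v ^^ Poly_Mapping.lookup \<alpha> v) (const c * f) S =
    const c * Finite_Set.fold (\<lambda>v. pd v ^^ Poly_Mapping.lookup \<alpha> v) f S"
    if "finite S" for S
    using that by (induction S) (auto simp: pd_pow_linear)
  then show "monomial_act \<alpha> (f + g) = monomial_act \<alpha> f + monomial_act \<alpha> g"
    "monomial_act \<alpha> (const c * f) = const c * monomial_act \<alpha> f"
    by (auto simp: monomial_act_def)
qed

lemma const_add: "const (a + b) = const a + const (b :: 'k::field)"
  by (simp add: const_def single_add)

lemma const_mult: "const (a * b) = const a * const (b :: 'k::field)"
  by (simp add: const_def mult_single)

lemma const_0 [simp]: "const 0 = (0 :: 'k::field mpoly)"
  by (simp add: const_def)

lemma const_1 [simp]: "const 1 = (1 :: 'k::field mpoly)"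
  by (simp add: const_def)

lemma act_superset:
  assumes "finite S" "Poly_Mapping.keys p \<subseteq> S"
  shows "act p f = (\<Sum>\<alpha>\<in>S. const (Poly_Mapping.lookup p \<alpha>) * monomial_act \<alpha> f)"
  unfolding act_def
  by (rule sum.mono_neutral_left) (use assms in \<open>auto simp: in_keys_iff\<close>)

lemma act_zero_left [simp]: "act 0 f = 0"
  by (simp add: act_def)

lemma act_add_left: "act (p + q) f = act p f + act q (f :: 'k::field mpoly)"
proof -
  let ?S = "Poly_Mapping.keys p \<union> Poly_Mapping.keys q"
  have "Poly_Mapping.keys (p + q) \<subseteq> ?S" by (rule keys_add)
  then show ?thesis
    by (simp add: act_superset[of ?S] lookup_add const_add distrib_right sum.distrib)
qed

lemma act_sum_left: "act (\<Sum>i\<in>S. p i) f = (\<Sum>i\<in>S. act (p i) (f :: 'k::field mpoly))"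
  by (induction S rule: infinite_finite_induct) (auto simp: act_add_left)

lemma monomial_act_sum:
  "monomial_act \<alpha> (\<Sum>i\<in>S. h i) = (\<Sum>i\<in>S. monomial_act \<alpha> (h i :: 'k::field mpoly))"
proof -
  have "monomial_act \<alpha> (0 :: 'k mpoly) = 0"
    using monomial_act_linear(2)[of \<alpha> "0::'k" 0] by simp
  then show ?thesis
    by (induction S rule: infinite_finite_induct) (auto simp: monomial_act_linear)
qed

lemma act_single: "act (Poly_Mapping.single \<alpha> c) f = const c * monomial_act \<alpha> (f :: 'k::field mpoly)"
  by (cases "c = 0") (auto simp: act_def)

lemma mpoly_as_sum:
  "p = (\<Sum>\<alpha>\<in>Poly_Mapping.keys p. Poly_Mapping.single \<alpha> (Poly_Mapping.lookup p \<alpha>))"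
  by (rule poly_mapping_eqI) (auto simp: lookup_sum lookup_single when_def in_keys_iff)

text \<open>\<open>act\<close> is the ring action determined by letting each variable act as a derivative.\<close>

lemma act_mult: "act (p * q) f = act p (act q (f :: 'k::field mpoly))"
proof -
  let ?s = "\<lambda>p \<alpha>. Poly_Mapping.single \<alpha> (Poly_Mapping.lookup p \<alpha>)"
  have *: "act (?s p \<alpha> * ?s q \<beta>) f = act (?s p \<alpha>) (act (?s q \<beta>) f)" for \<alpha> \<beta>
    by (simp add: mult_single act_single monomial_act_add monomial_act_linear const_mult mult.assoc)
  have "act (p * q) f =
    act (\<Sum>\<alpha>\<in>Poly_Mapping.keys p. \<Sum>\<beta>\<in>Poly_Mapping.keys q. ?s p \<alpha> * ?s q \<beta>) f"
    by (subst mpoly_as_sum[of p], subst mpoly_as_sum[of q]) (simp only: sum_product)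
  also have "\<dots> = (\<Sum>\<alpha>\<in>Poly_Mapping.keys p. \<Sum>\<beta>\<in>Poly_Mapping.keys q. act (?s p \<alpha>) (act (?s q \<beta>) f))"
    by (simp add: act_sum_left *)
  also have "\<dots> = (\<Sum>\<alpha>\<in>Poly_Mapping.keys p. act (?s p \<alpha>) (\<Sum>\<beta>\<in>Poly_Mapping.keys q. act (?s q \<beta>) f))"
    by (simp add: act_single monomial_act_sum sum_distrib_left)
  also have "\<dots> = act p (act q f)"
    by (simp add: act_def[of p] act_def[of q] act_single)
  finally show ?thesis .
qed

lemma act_var:
  "act (varX i) f = pd (Xvar i) (f :: 'k::field mpoly)"
  "act (varU j) f = pd (Uvar j) (f :: 'k::field mpoly)"
  by (simp_all add: varX_def varU_def act_single monomial_act_def)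

lemma act_const: "act (const c) f = const c * (f :: 'k::field mpoly)"
  by (simp add: const_def[of c] act_single monomial_act_def)

lemma poly_ring_cring: "cring (poly_ring n m :: 'k::field mpoly ring)"
proof (rule cringI)
  let ?V = "Xvar ` {1..n} \<union> Uvar ` {1..m}"
  let ?R = "poly_ring n m :: 'k mpoly ring"
  have carrier: "p \<in> carrier ?R \<longleftrightarrow> (\<forall>\<alpha>\<in>Poly_Mapping.keys p. Poly_Mapping.keys \<alpha> \<subseteq> ?V)" for p
    by (simp only: poly_ring_def partial_object.simps mem_Collect_eq)
  have mult: "p * q \<in> carrier ?R" if "p \<in> carrier ?R" "q \<in> carrier ?R" for p q
  proof -
    have "Poly_Mapping.keys \<gamma> \<subseteq> ?V" if "p \<in> carrier ?R" "q \<in> carrier ?R"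
      and \<gamma>: "\<gamma> \<in> Poly_Mapping.keys (p * q)" for \<gamma>
    proof -
      from \<gamma> keys_mult[of p q] obtain \<alpha> \<beta> where
        "\<gamma> = \<alpha> + \<beta>" "\<alpha> \<in> Poly_Mapping.keys p" "\<beta> \<in> Poly_Mapping.keys q" by blast
      with that(1) that(2) have "Poly_Mapping.keys \<alpha> \<subseteq> ?V" "Poly_Mapping.keys \<beta> \<subseteq> ?V" "\<gamma> = \<alpha> + \<beta>"
        by (simp_all add: carrier)
      with Poly_Mapping.keys_add[of \<alpha> \<beta>] show ?thesis by blast
    qed
    then show ?thesis using that by (subst carrier) blast
  qed
  have add: "p + q \<in> carrier ?R" if "p \<in> carrier ?R" "q \<in> carrier ?R" for p q
    using that Poly_Mapping.keys_add[of p q] unfolding carrier by blast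
  have uminus: "- p \<in> carrier ?R" if "p \<in> carrier ?R" for p
    using that unfolding carrier keys_minus .
  have ops: "x \<oplus>\<^bsub>?R\<^esub> y = x + y" "x \<otimes>\<^bsub>?R\<^esub> y = x * y" "\<zero>\<^bsub>?R\<^esub> = 0" "\<one>\<^bsub>?R\<^esub> = 1" for x y
    by (simp_all add: poly_ring_def)
  have zero_one: "0 \<in> carrier ?R" "1 \<in> carrier ?R"
    by (simp_all add: poly_ring_def)
  show "abelian_group ?R"
  proof (rule abelian_groupI)
    fix x assume "x \<in> carrier ?R"
    then show "\<exists>y\<in>carrier ?R. y \<oplus>\<^bsub>?R\<^esub> x = \<zero>\<^bsub>?R\<^esub>"
      by (intro bexI[of _ "- x"] uminus) (simp add: ops)
  qed (simp_all only: ops zero_one add ac_simps add_0_left add_0_right)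
  show "comm_monoid ?R"
    by (rule comm_monoidI) (simp_all only: ops zero_one mult ac_simps mult_1_left mult_1_right)
  show "(x \<oplus>\<^bsub>?R\<^esub> y) \<otimes>\<^bsub>?R\<^esub> z = x \<otimes>\<^bsub>?R\<^esub> z \<oplus>\<^bsub>?R\<^esub> y \<otimes>\<^bsub>?R\<^esub> z" for x y z
    by (simp only: ops distrib_right)
qed

lemma Ann_ideal: "ideal (Ann n m f) (poly_ring n m :: 'k::field mpoly ring)"
proof -
  let ?R = "poly_ring n m :: 'k mpoly ring"
  interpret cring ?R by (rule poly_ring_cring)
  have act_m: "act (- p) f = - act p f" for p
    using act_add_left[of p "- p" f] by (simp add: eq_neg_iff_add_eq_0 add.commute)
  have inv: "\<ominus>\<^bsub>?R\<^esub> p = - p" if "p \<in> carrier ?R" for p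
    by (rule minus_equality) (use that in \<open>auto simp: poly_ring_def\<close>)
  have closed: "p + q \<in> carrier ?R" "p * q \<in> carrier ?R" if "p \<in> carrier ?R" "q \<in> carrier ?R" for p q
    using add.m_closed[OF that] m_closed[OF that] by (simp_all add: poly_ring_def)
  have act_0: "act p 0 = 0" for p :: "'k mpoly"
    using act_mult[of p 0 0] by simp
  show ?thesis
  proof (rule idealI)
    show "subgroup (Ann n m f) (add_monoid ?R)"
    proof (rule add.subgroupI)
      have "0 \<in> Ann n m f" by (simp add: Ann_def poly_ring_def)
      then show "Ann n m f \<noteq> {}" by blast
      show "\<ominus>\<^bsub>?R\<^esub> p \<in> Ann n m f" if "p \<in> Ann n m f" for p
        using that add.inv_closed inv by (fastforce simp: Ann_def act_m)
      show "p \<oplus>\<^bsub>?R\<^esub> q \<in> Ann n m f" if "p \<in> Ann n m f" "q \<in> Ann n m f" for p q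
        using that closed(1)[of p q] by (auto simp: Ann_def act_add_left poly_ring_def)
    qed (auto simp: Ann_def)
  next
    fix p q assume *: "p \<in> Ann n m f" "q \<in> carrier ?R"
    then show "q \<otimes>\<^bsub>?R\<^esub> p \<in> Ann n m f"
      using closed(2)[of q p] by (auto simp: Ann_def act_mult act_0 poly_ring_def)
    from * show "p \<otimes>\<^bsub>?R\<^esub> q \<in> Ann n m f"
      using closed(2)[of q p] by (auto simp: Ann_def act_mult act_0 poly_ring_def mult.commute[of p q])
  qed (rule ring_axioms)
qed

lemma quot_algebra_vectorspace:
  assumes "ideal I (poly_ring n m :: 'k::field mpoly ring)"
  shows "vectorspace class_ring (quot_algebra n m I)"
proof -
  let ?R = "poly_ring n m :: 'k mpoly ring"
  let ?A = "?R Quot I"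
  let ?M = "quot_algebra n m I"
  let ?c = "quot_class n m I"
  interpret I: ideal I ?R by fact
  interpret R: cring ?R by (rule poly_ring_cring)
  interpret A: cring ?A by (rule I.quotient_is_cring[OF poly_ring_cring])
  have hom: "?c \<in> Ring.ring_hom ?R ?A"
    using I.rcos_ring_hom unfolding quot_class_def by simp
  have cR: "const a \<in> carrier ?R" for a :: 'k
    by (auto simp: const_def poly_ring_def split: if_splits)
  have cA: "?c (const a) \<in> carrier ?A" for a
    using ring_hom_closed[OF hom cR] .
  have M: "carrier ?M = carrier ?A" "add ?M = add ?A" "zero ?M = zero ?A" "mult ?M = mult ?A"
     "one ?M = one ?A" "smult ?M a x = ?c (const a) \<otimes>\<^bsub>?A\<^esub> x" for a x
    by (simp_all add: quot_algebra_def Let_def)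
  have c_add: "?c (const (a + b)) = ?c (const a) \<oplus>\<^bsub>?A\<^esub> ?c (const b)" for a b
    using ring_hom_add[OF hom cR cR, of a b] by (simp add: const_add poly_ring_def)
  have c_mult: "?c (const (a * b)) = ?c (const a) \<otimes>\<^bsub>?A\<^esub> ?c (const b)" for a b
    using ring_hom_mult[OF hom cR cR, of a b] by (simp add: const_mult poly_ring_def)
  have c_one: "?c 1 = one ?A"
    using ring_hom_one[OF hom] by (simp add: poly_ring_def)
  have "abelian_group ?M"
    by (rule abelian_groupI)
       (use A.add.m_closed A.a_assoc A.a_comm A.l_neg A.add.inv_closed in \<open>auto simp: M\<close>)
  then have "module class_ring ?M"
    by (intro Module.module.intro Module.module_axioms.intro class_cring.cring_axioms)
       (auto simp: M cA c_add c_mult c_one A.l_distr A.r_distr A.m_assoc)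
  then show ?thesis
    by (intro vectorspace.intro class_field.field_axioms)
qed

lemma piece_vectorspace:
  assumes I: "ideal I (poly_ring n m :: 'k::field mpoly ring)"
    and W: "W \<subseteq> carrier (poly_ring n m)" "0 \<in> W"
      "\<And>p q. p \<in> W \<Longrightarrow> q \<in> W \<Longrightarrow> p + q \<in> W" "\<And>a p. p \<in> W \<Longrightarrow> const a * p \<in> W"
  shows "vectorspace class_ring ((quot_algebra n m I)\<lparr>carrier := quot_class n m I ` W\<rparr>)"
proof -
  let ?R = "poly_ring n m :: 'k mpoly ring"
  let ?A = "?R Quot I"
  let ?M = "quot_algebra n m I"
  let ?c = "quot_class n m I"
  interpret I: ideal I ?R by fact
  interpret vectorspace class_ring ?M by (rule quot_algebra_vectorspace[OF I])
  have hom: "?c \<in> Ring.ring_hom ?R ?A"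
    using I.rcos_ring_hom unfolding quot_class_def by simp
  have cR: "const a \<in> carrier ?R" for a :: 'k
    by (auto simp: const_def poly_ring_def split: if_splits)
  have M: "carrier ?M = carrier ?A" "add ?M = add ?A" "zero ?M = zero ?A"
     "smult ?M a x = ?c (const a) \<otimes>\<^bsub>?A\<^esub> x" for a x
    by (simp_all add: quot_algebra_def Let_def)
  have ops: "?c p \<oplus>\<^bsub>?A\<^esub> ?c q = ?c (p + q)" "?c p \<otimes>\<^bsub>?A\<^esub> ?c q = ?c (p * q)"
    if "p \<in> carrier ?R" "q \<in> carrier ?R" for p q
    using ring_hom_add[OF hom that] ring_hom_mult[OF hom that] by (simp_all add: poly_ring_def)
  have zero: "\<zero>\<^bsub>?A\<^esub> = ?c 0"
    using ring_hom_zero[OF hom I.ring_axioms I.quotient_is_ring] by (simp add: poly_ring_def)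
  have "submodule class_ring (?c ` W) ?M"
  proof (rule submodule.intro)
    show "Module.module class_ring ?M" by (rule module_axioms)
    show "?c ` W \<subseteq> carrier ?M"
      unfolding M using W(1) ring_hom_closed[OF hom] by blast
    show "\<zero>\<^bsub>?M\<^esub> \<in> ?c ` W"
      unfolding M zero using W(2) by blast
    show "v \<oplus>\<^bsub>?M\<^esub> w \<in> ?c ` W" if "v \<in> ?c ` W" "w \<in> ?c ` W" for v w
    proof -
      from that obtain p q where pq: "p \<in> W" "q \<in> W" "v = ?c p" "w = ?c q" by blast
      then have "v \<oplus>\<^bsub>?M\<^esub> w = ?c (p + q)" unfolding M pq(3,4) by (intro ops(1) subsetD[OF W(1)])
      with W(3)[OF pq(1,2)] show ?thesis by simp
    qed
    show "a \<odot>\<^bsub>?M\<^esub> v \<in> ?c ` W" if "a \<in> carrier class_ring" "v \<in> ?c ` W" for a v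
    proof -
      from that obtain p where p: "p \<in> W" "v = ?c p" by blast
      then have "a \<odot>\<^bsub>?M\<^esub> v = ?c (const a * p)" unfolding M p(2) by (intro ops(2) cR subsetD[OF W(1)])
      with W(4)[OF p(1)] show ?thesis by simp
    qed
  qed
  then have "VectorSpace.subspace class_ring (?c ` W) ?M"
    by (rule VectorSpace.subspace.intro[OF vectorspace_axioms])
  then show ?thesis by (rule subspace_is_vs)
qed

lemma const_mult_keys: "Poly_Mapping.keys (const a * p) \<subseteq> Poly_Mapping.keys (p :: 'k::field mpoly)"
  by (intro subsetI) (simp add: in_keys_iff lookup_const_mult)

lemma bigraded_piece_vectorspace:
  assumes "ideal I (poly_ring n m :: 'k::field mpoly ring)"
  shows "vectorspace class_ring (bigraded_piece n m I i j)"
proof -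
  have mem: "p \<in> bihom_part n m i j \<longleftrightarrow> (\<forall>\<alpha>\<in>Poly_Mapping.keys p.
      Poly_Mapping.keys \<alpha> \<subseteq> Xvar ` {1..n} \<union> Uvar ` {1..m} \<and> int (X_degree \<alpha>) = i \<and> int (U_degree \<alpha>) = j)" for p :: "'k mpoly"
    by (auto simp: bihom_part_def poly_ring_def)
  show ?thesis
    unfolding bigraded_piece_def
  proof (rule piece_vectorspace[OF assms])
    show "bihom_part n m i j \<subseteq> carrier (poly_ring n m)" by (simp add: bihom_part_def subset_iff)
    show "(0 :: 'k mpoly) \<in> bihom_part n m i j" by (simp add: mem)
    show "p + q \<in> bihom_part n m i j" if "p \<in> bihom_part n m i j" "q \<in> bihom_part n m i j" for p q :: "'k mpoly"
      using that Poly_Mapping.keys_add[of p q] unfolding mem by blast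
    show "const a * p \<in> bihom_part n m i j" if "p \<in> bihom_part n m i j" for a and p :: "'k mpoly"
      using that const_mult_keys[of a p] unfolding mem by blast
  qed
qed

lemma graded_piece_vectorspace:
  assumes "ideal I (poly_ring n m :: 'k::field mpoly ring)"
  shows "vectorspace class_ring (graded_piece n m I k)"
proof -
  have mem: "p \<in> hom_part n m k \<longleftrightarrow> (\<forall>\<alpha>\<in>Poly_Mapping.keys p.
      Poly_Mapping.keys \<alpha> \<subseteq> Xvar ` {1..n} \<union> Uvar ` {1..m} \<and> int (X_degree \<alpha> + U_degree \<alpha>) = k)" for p :: "'k mpoly"
    by (auto simp: hom_part_def poly_ring_def)
  show ?thesis
    unfolding graded_piece_def
  proof (rule piece_vectorspace[OF assms])
    show "hom_part n m k \<subseteq> carrier (poly_ring n m)" by (simp add: hom_part_def subset_iff)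
    show "(0 :: 'k mpoly) \<in> hom_part n m k" by (simp add: mem)
    show "p + q \<in> hom_part n m k" if "p \<in> hom_part n m k" "q \<in> hom_part n m k" for p q :: "'k mpoly"
      using that Poly_Mapping.keys_add[of p q] unfolding mem by blast
    show "const a * p \<in> hom_part n m k" if "p \<in> hom_part n m k" for a and p :: "'k mpoly"
      using that const_mult_keys[of a p] unfolding mem by blast
  qed
qed

end

theory Submission
  imports Defs
begin

text \<open>
  Every partial derivative of \<open>f\<close> is square-free, so \<open>Q\<close> acts on \<open>f\<close> by contraction: no
  coefficients arise, and the coefficient of \<open>\<beta>\<close> in \<open>p(f)\<close> is the sum of the coefficients of \<open>p\<close> at
  the \<open>\<alpha>\<close> for which \<open>\<alpha> + \<beta>\<close> occurs in \<open>f\<close>. Hence \<open>p(f) = 0\<close> if and only if finitely many linear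
  forms vanish at \<open>p\<close>: for each face \<open>F\<close> the coefficient of \<open>U_F\<close> in \<open>p\<close>, which is also the
  coefficient of \<open>x_i (g_i / F)\<close> in \<open>p(f)\<close> for every \<open>g_i\<close> containing \<open>F\<close>, and for each face \<open>G\<close> the
  coefficient of \<open>G\<close> in \<open>p(f)\<close>. The monomials \<open>U_F\<close> and, for any facet \<open>g_i\<close> containing \<open>G\<close>,
  \<open>X_i (g_i / G)\<close> are dual to these forms, and each form only sees one bidegree, \<open>(0, |F|)\<close>
  respectively \<open>(1, d - 1 - |G|)\<close>. This yields bases of all graded pieces, the direct sum and the
  perfect pairing. For the generators, each monomial either lies in the ideal \<open>J\<close> they generate or is
  congruent modulo \<open>J\<close> to one of the dual monomials; so every \<open>p\<close> is congruent modulo \<open>J\<close> to the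
  combination given by its coordinates, which is zero for \<open>p\<close> in the annihilator.
\<close>

section \<open>Quotients of the polynomial ring\<close>

lemma in_poly_ring_iff:
  "p \<in> carrier (poly_ring n m :: 'k::field mpoly ring) \<longleftrightarrow>
     (\<forall>\<alpha>\<in>Poly_Mapping.keys p. Poly_Mapping.keys \<alpha> \<subseteq> Xvar ` {1..n} \<union> Uvar ` {1..m})"
  by (simp add: poly_ring_def)

lemma poly_ring_ops:
  "x \<oplus>\<^bsub>poly_ring n m\<^esub> y = x + y" "x \<otimes>\<^bsub>poly_ring n m\<^esub> y = x * y"
  "\<zero>\<^bsub>poly_ring n m\<^esub> = 0" "\<one>\<^bsub>poly_ring n m\<^esub> = 1"
  by (simp_all add: poly_ring_def)

lemma poly_ring_add: "p \<in> carrier (poly_ring n m) \<Longrightarrow> q \<in> carrier (poly_ring n m) \<Longrightarrow> p + q \<in> carrier (poly_ring n m)"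
  and poly_ring_mult: "p \<in> carrier (poly_ring n m) \<Longrightarrow> q \<in> carrier (poly_ring n m) \<Longrightarrow> p * q \<in> carrier (poly_ring n m)"
  for p q :: "'k::field mpoly"
proof -
  interpret cring "poly_ring n m :: 'k mpoly ring" by (rule poly_ring_cring)
  show "p \<in> carrier (poly_ring n m) \<Longrightarrow> q \<in> carrier (poly_ring n m) \<Longrightarrow> p + q \<in> carrier (poly_ring n m)"
    and "p \<in> carrier (poly_ring n m) \<Longrightarrow> q \<in> carrier (poly_ring n m) \<Longrightarrow> p * q \<in> carrier (poly_ring n m)"
    using a_closed[of p q] m_closed[of p q] by (simp_all add: poly_ring_ops)
qed

lemma poly_ring_0: "0 \<in> carrier (poly_ring n m :: 'k::field mpoly ring)"
  by (simp add: in_poly_ring_iff)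

lemma poly_ring_const: "const c \<in> carrier (poly_ring n m :: 'k::field mpoly ring)"
  by (auto simp: const_def in_poly_ring_iff split: if_splits)

lemma poly_ring_single:
  assumes "Poly_Mapping.keys \<alpha> \<subseteq> Xvar ` {1..n} \<union> Uvar ` {1..m}"
  shows "Poly_Mapping.single \<alpha> c \<in> carrier (poly_ring n m :: 'k::field mpoly ring)"
  using assms by (simp add: in_poly_ring_iff)

lemma poly_ring_uminus: "p \<in> carrier (poly_ring n m) \<Longrightarrow> - p \<in> carrier (poly_ring n m :: 'k::field mpoly ring)"
  by (simp add: in_poly_ring_iff)

lemma poly_ring_diff: "p \<in> carrier (poly_ring n m) \<Longrightarrow> q \<in> carrier (poly_ring n m) \<Longrightarrow>
   p - q \<in> carrier (poly_ring n m :: 'k::field mpoly ring)"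
  using poly_ring_add[of p n m "- q"] poly_ring_uminus[of q] by simp

lemma poly_ring_sum: "(\<And>i. i \<in> S \<Longrightarrow> p i \<in> carrier (poly_ring n m)) \<Longrightarrow>
   (\<Sum>i\<in>S. p i) \<in> carrier (poly_ring n m :: 'k::field mpoly ring)"
  by (induction S rule: infinite_finite_induct) (simp_all add: poly_ring_0 poly_ring_add)

lemma poly_ring_a_inv:
  assumes "p \<in> carrier (poly_ring n m :: 'k::field mpoly ring)"
  shows "\<ominus>\<^bsub>poly_ring n m\<^esub> p = - p"
proof -
  interpret cring "poly_ring n m :: 'k mpoly ring" by (rule poly_ring_cring)
  show ?thesis
    by (rule minus_equality) (use assms poly_ring_uminus[OF assms] in \<open>simp_all add: poly_ring_ops\<close>)
qed

text \<open>Stated for an arbitrary ideal because it serves twice: for the annihilator, and for the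
  ideal spanned by the proposed generators when the two are compared.\<close>

locale poly_ideal =
  fixes n m :: nat and I :: "'k::field mpoly set"
  assumes ideal: "ideal I (poly_ring n m :: 'k::field mpoly ring)"
begin

abbreviation "R \<equiv> (poly_ring n m :: 'k mpoly ring)"
abbreviation "A \<equiv> quot_algebra n m I"
abbreviation "cls \<equiv> quot_class n m I"

lemma sub: "p \<in> I \<Longrightarrow> p \<in> carrier R"
  using additive_subgroup.a_Hcarr[OF ideal.axioms(1)[OF ideal]] .

lemma I_0: "0 \<in> I"
  using additive_subgroup.zero_closed[OF ideal.axioms(1)[OF ideal]] by (simp add: poly_ring_ops)

lemma I_add: "p \<in> I \<Longrightarrow> q \<in> I \<Longrightarrow> p + q \<in> I"
  using additive_subgroup.a_closed[OF ideal.axioms(1)[OF ideal]] by (simp add: poly_ring_ops)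

lemma I_mult: "p \<in> I \<Longrightarrow> q \<in> carrier R \<Longrightarrow> q * p \<in> I"
  using ideal.I_l_closed[OF ideal] by (simp add: poly_ring_ops)

lemma I_single_add:
  assumes "Poly_Mapping.single \<gamma> 1 \<in> I" "Poly_Mapping.keys \<delta> \<subseteq> Xvar ` {1..n} \<union> Uvar ` {1..m}"
  shows "Poly_Mapping.single (\<gamma> + \<delta>) 1 \<in> I"
  using I_mult[OF assms(1) poly_ring_single[OF assms(2)], of 1] by (simp add: mult_single add.commute)

lemma I_sum: "(\<And>i. i \<in> S \<Longrightarrow> p i \<in> I) \<Longrightarrow> (\<Sum>i\<in>S. p i) \<in> I"
  by (induction S rule: infinite_finite_induct) (simp_all add: I_0 I_add)

lemma carrier_A: "carrier A = cls ` carrier R"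
  by (auto simp: quot_algebra_def Let_def FactRing_def A_RCOSETS_def' quot_class_def)

lemma cls_eq_iff:
  assumes "p \<in> carrier R" "q \<in> carrier R"
  shows "cls p = cls q \<longleftrightarrow> p - q \<in> I"
proof -
  interpret ideal I R by (rule ideal)
  have "p - q = p \<ominus>\<^bsub>R\<^esub> q"
    using assms by (simp add: a_minus_def poly_ring_ops poly_ring_a_inv)
  then show ?thesis
    using quotient_eq_iff_same_a_r_cos[OF ideal, of p q] assms
    unfolding quot_class_def by simp
qed

lemma cls_add: "p \<in> carrier R \<Longrightarrow> q \<in> carrier R \<Longrightarrow> cls p \<oplus>\<^bsub>A\<^esub> cls q = cls (p + q)"
  using ring_hom_add[OF ideal.rcos_ring_hom[OF ideal], of p q]
  by (simp add: quot_algebra_def Let_def quot_class_def poly_ring_ops)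

lemma cls_smult: "p \<in> carrier R \<Longrightarrow> c \<odot>\<^bsub>A\<^esub> cls p = cls (const c * p)"
  using ring_hom_mult[OF ideal.rcos_ring_hom[OF ideal], of "const c" p] poly_ring_const[of c n m]
  by (simp add: quot_algebra_def Let_def quot_class_def poly_ring_ops)

lemma cls_zero: "\<zero>\<^bsub>A\<^esub> = cls 0"
  using ring_hom_zero[OF ideal.rcos_ring_hom[OF ideal] poly_ring_cring[THEN cring.axioms(1)]
     ideal.quotient_is_ring[OF ideal]]
  by (simp add: quot_algebra_def Let_def quot_class_def poly_ring_ops)

lemma cls_eq_zero_iff: "p \<in> carrier R \<Longrightarrow> cls p = \<zero>\<^bsub>A\<^esub> \<longleftrightarrow> p \<in> I"
  by (simp add: cls_zero cls_eq_iff poly_ring_0)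

end

section \<open>Images of linear subspaces in the quotient, and coordinates on them\<close>

locale quot_subspace = poly_ideal n m I for n m and I :: "'k::field mpoly set" +
  fixes W :: "'k mpoly set"
  assumes W_sub: "W \<subseteq> carrier (poly_ring n m)"
    and W_0: "0 \<in> W"
    and W_add: "\<And>p q. p \<in> W \<Longrightarrow> q \<in> W \<Longrightarrow> p + q \<in> W"
    and W_const: "\<And>c p. p \<in> W \<Longrightarrow> const c * p \<in> W"
begin

abbreviation "V \<equiv> (quot_algebra n m I)\<lparr>carrier := quot_class n m I ` W\<rparr>"

sublocale V: vectorspace class_ring V
  by (rule piece_vectorspace[OF ideal W_sub W_0 W_add W_const])

lemma W_sum: "(\<And>i. i \<in> S \<Longrightarrow> p i \<in> W) \<Longrightarrow> (\<Sum>i\<in>S. p i) \<in> W"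
  by (induction S rule: infinite_finite_induct) (simp_all add: W_0 W_add)

lemma finsum_cls:
  assumes "\<And>i. i \<in> S \<Longrightarrow> p i \<in> W"
  shows "finsum V (\<lambda>i. cls (p i)) S = cls (\<Sum>i\<in>S. p i)"
  using assms
proof (induction S rule: infinite_finite_induct)
  case (insert x F)
  have "finsum V (\<lambda>i. cls (p i)) (insert x F) = cls (p x) \<oplus>\<^bsub>V\<^esub> finsum V (\<lambda>i. cls (p i)) F"
    using insert by (intro V.finsum_insert) auto
  also have "\<dots> = cls (p x) \<oplus>\<^bsub>A\<^esub> cls (\<Sum>i\<in>F. p i)"
    using insert by simp
  also have "\<dots> = cls (p x + (\<Sum>i\<in>F. p i))"
    using insert.prems W_sub W_sum[of F p] by (intro cls_add) auto
  finally show ?case using insert by simp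
\<comment> \<open>Over an infinite index set both sums default to zero, so no finiteness has to be
  carried along.\<close>
qed (use V.finsum_empty V.finsum_infinite in \<open>simp_all add: cls_zero\<close>)

end

text \<open>Dual bases modulo \<open>I\<close>: the forms \<open>\<phi> t\<close> are biorthogonal
  to the elements \<open>b t\<close> and cut out \<open>I\<close> inside \<open>W\<close>. They
  therefore descend to coordinates on the image of \<open>W\<close> with respect to the classes of
  the \<open>b t\<close>. Being linear on all polynomials, they can be combined freely without
  checking membership in \<open>W\<close>.\<close>

locale quot_coords = quot_subspace n m I W for n m and I :: "'k::field mpoly set" and W +
  fixes T :: "'t set" and b :: "'t \<Rightarrow> 'k mpoly" and \<phi> :: "'t \<Rightarrow> 'k mpoly \<Rightarrow> 'k"
  assumes T_fin: "finite T"
    and b_W: "\<And>t. t \<in> T \<Longrightarrow> b t \<in> W"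
    and \<phi>_add: "\<And>t p q. \<phi> t (p + q) = \<phi> t p + \<phi> t q"
    and \<phi>_const: "\<And>t c p. \<phi> t (const c * p) = c * \<phi> t p"
    and \<phi>_b: "\<And>s t. s \<in> T \<Longrightarrow> t \<in> T \<Longrightarrow> \<phi> s (b t) = (if s = t then 1 else 0)"
    and \<phi>_I: "\<And>p. p \<in> W \<Longrightarrow> p \<in> I \<longleftrightarrow> (\<forall>t\<in>T. \<phi> t p = 0)"
begin

lemma \<phi>_0: "\<phi> t 0 = 0"
  using \<phi>_const[of t 0 0] by simp

lemma \<phi>_diff: "\<phi> t (p - q) = \<phi> t p - \<phi> t q"
  using \<phi>_add[of t "p - q" q] by (simp add: eq_diff_eq)

lemma \<phi>_sum: "\<phi> t (\<Sum>i\<in>S. p i) = (\<Sum>i\<in>S. \<phi> t (p i))"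
  by (induction S rule: infinite_finite_induct) (simp_all add: \<phi>_0 \<phi>_add)

lemma \<phi>_lincomb: "t \<in> T \<Longrightarrow> \<phi> t (\<Sum>s\<in>T. const (c s) * b s) = c t"
proof -
  assume t: "t \<in> T"
  then have "\<phi> t (\<Sum>s\<in>T. const (c s) * b s) = (\<Sum>s\<in>T. if s = t then c t else 0)"
    unfolding \<phi>_sum \<phi>_const by (intro sum.cong) (auto simp: \<phi>_b)
  then show ?thesis using T_fin t by simp
qed

lemma lincomb_W: "(\<Sum>s\<in>T. const (c s) * b s) \<in> W"
  by (intro W_sum W_const b_W)

lemma W_diff: "p \<in> W \<Longrightarrow> q \<in> W \<Longrightarrow> p - q \<in> W"
  using W_add[of p "const (-1) * q"] W_const[of q "-1"] by (simp add: const_def single_uminus)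

lemma cls_eq_iff_\<phi>:
  assumes "p \<in> W" "q \<in> W"
  shows "cls p = cls q \<longleftrightarrow> (\<forall>t\<in>T. \<phi> t p = \<phi> t q)"
  using assms W_sub by (simp add: cls_eq_iff subset_iff \<phi>_I[OF W_diff] \<phi>_diff)

text \<open>The form \<open>\<phi> s\<close> is 1 on \<open>b s\<close> and 0 on every other
  \<open>b t\<close>, hence separates their classes.\<close>

lemma inj_cls_b: "inj_on (\<lambda>t. cls (b t)) T"
proof (rule inj_onI)
  fix s t assume st: "s \<in> T" "t \<in> T" "cls (b s) = cls (b t)"
  then have "\<phi> s (b s) = \<phi> s (b t)" using cls_eq_iff_\<phi>[of "b s" "b t"] b_W by auto
  then show "s = t" using st by (auto simp: \<phi>_b split: if_splits)
qed

text \<open>\<open>lincomb\<close> sums over a set of vectors, not over an indexed family;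
  injectivity of the indexing turns this into a sum over \<open>T\<close>, which can be pulled back
  to polynomials.\<close>

lemma lincomb_cls:
  "V.lincomb a ((\<lambda>t. cls (b t)) ` T) = cls (\<Sum>t\<in>T. const (a (cls (b t))) * b t)"
proof -
  have "V.lincomb a ((\<lambda>t. cls (b t)) ` T) = finsum V (\<lambda>t. a (cls (b t)) \<odot>\<^bsub>V\<^esub> cls (b t)) T"
    unfolding V.lincomb_def using inj_cls_b b_W W_const W_sub
    by (intro V.finsum_reindex) (auto simp: cls_smult subset_iff)
  also have "\<dots> = finsum V (\<lambda>t. cls (const (a (cls (b t))) * b t)) T"
    using b_W W_sub W_const by (intro V.finsum_cong') (auto simp: cls_smult subset_iff)
  also have "\<dots> = cls (\<Sum>t\<in>T. const (a (cls (b t))) * b t)"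
    by (intro finsum_cls W_const b_W)
  finally show ?thesis .
qed

text \<open>The coefficients of the class of \<open>p\<close> are forced to be the values
  \<open>\<phi> t p\<close>, and these do give back the class, so each vector has exactly one
  expansion.\<close>

lemma basis: "V.basis ((\<lambda>t. cls (b t)) ` T)"
proof -
  have "\<exists>!a. a \<in> (\<lambda>t. cls (b t)) ` T \<rightarrow>\<^sub>E carrier class_ring \<and> V.lincomb a ((\<lambda>t. cls (b t)) ` T) = v"
    if "v \<in> carrier V" for v
  proof -
    from that obtain p where p: "p \<in> W" "v = cls p" by auto
    \<comment> \<open>Coefficients are functions of the vector, so the index is recovered by
      \<open>inv_into\<close>. The restriction places \<open>a\<close> in the extensional function
      space in which uniqueness is asserted.\<close>
    define a where "a = (\<lambda>x\<in>(\<lambda>t. cls (b t)) ` T. \<phi> (inv_into T (\<lambda>t. cls (b t)) x) p)"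
    have a: "a (cls (b t)) = \<phi> t p" if "t \<in> T" for t
      using that inv_into_f_f[OF inj_cls_b that] by (simp add: a_def)
    have eq: "V.lincomb a' ((\<lambda>t. cls (b t)) ` T) = v \<longleftrightarrow> (\<forall>t\<in>T. a' (cls (b t)) = \<phi> t p)" for a'
      unfolding lincomb_cls p(2) by (subst cls_eq_iff_\<phi>) (auto simp: lincomb_W p(1) \<phi>_lincomb)
    show ?thesis
    proof (rule ex1I[of _ a])
      show "a \<in> (\<lambda>t. cls (b t)) ` T \<rightarrow>\<^sub>E carrier class_ring \<and> V.lincomb a ((\<lambda>t. cls (b t)) ` T) = v"
        unfolding eq by (auto simp: a) (simp add: a_def)
      show "a' = a" if "a' \<in> (\<lambda>t. cls (b t)) ` T \<rightarrow>\<^sub>E carrier class_ring \<and> V.lincomb a' ((\<lambda>t. cls (b t)) ` T) = v" for a'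
        using that unfolding eq
        by (intro extensionalityI[of _ "(\<lambda>t. cls (b t)) ` T"]) (auto simp: a PiE_def, simp add: a_def)
    qed
  qed
  moreover have "(\<lambda>t. cls (b t)) ` T \<subseteq> carrier V"
    using b_W by auto
  ultimately show ?thesis
    using V.basis_criterion[of "(\<lambda>t. cls (b t)) ` T"] T_fin by blast
qed

lemma dim: "V.dim = card T"
  using V.dim_basis[OF _ basis] T_fin card_image[OF inj_cls_b] by simp

end

section \<open>Perfect pairings from two systems of coordinates with a common index set\<close>

locale quot_pairing =
  P: quot_coords n m I W T b \<phi> + Q: quot_coords n m I W' T b' \<psi>
  for n m and I :: "'k::field mpoly set" and W and T :: "'t set" and b \<phi> W' b' \<psi> +
  fixes \<beta> :: "'k mpoly \<Rightarrow> 'k mpoly \<Rightarrow> 'k"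
  assumes \<beta>: "\<And>p q. p \<in> W \<Longrightarrow> q \<in> W' \<Longrightarrow> \<beta> p q = (\<Sum>t\<in>T. \<phi> t p * \<psi> t q)"
begin

text \<open>With respect to the two bases the pairing has the identity matrix, so sending a vector
  to its pairing form is an isomorphism onto the dual space.\<close>

lemma perfect_pairing:
  "\<exists>\<Phi>. linear_iso P.V (dual_space Q.V) \<Phi> \<and> (\<forall>p\<in>W. \<forall>q\<in>W'. \<Phi> (P.cls p) (P.cls q) = \<beta> p q)"
proof -
  \<comment> \<open>Coordinates depend only on the class of an element of the subspace, so an
    arbitrary representative may be chosen to define the map on classes.\<close>
  define rep where "rep U v = (SOME p. p \<in> U \<and> P.cls p = v)" for U v
  have rep: "rep U (P.cls p) \<in> U" "P.cls (rep U (P.cls p)) = P.cls p" if "p \<in> U" for U p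
    using that someI[of "\<lambda>q. q \<in> U \<and> P.cls q = P.cls p" p] by (auto simp: rep_def)
  have \<phi>r: "\<phi> t (rep W (P.cls p)) = \<phi> t p" if "p \<in> W" "t \<in> T" for p t
    using rep[OF that(1)] P.cls_eq_iff_\<phi> that by blast
  have \<psi>r: "\<psi> t (rep W' (P.cls p)) = \<psi> t p" if "p \<in> W'" "t \<in> T" for p t
    using rep[OF that(1)] Q.cls_eq_iff_\<phi> that by blast
  define \<Phi> where "\<Phi> v = (\<lambda>w\<in>carrier Q.V. \<Sum>t\<in>T. \<phi> t (rep W v) * \<psi> t (rep W' w))" for v
  have \<Phi>: "\<Phi> (P.cls p) (P.cls q) = (\<Sum>t\<in>T. \<phi> t p * \<psi> t q)" if "p \<in> W" "q \<in> W'" for p q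
    using that by (simp add: \<Phi>_def \<phi>r \<psi>r)
  have ext: "\<Phi> v \<in> extensional (carrier Q.V)" for v
    by (simp add: \<Phi>_def)
  have form: "\<Phi> (P.cls p) \<in> carrier (dual_space Q.V)" if p: "p \<in> W" for p
  proof -
    have "\<Phi> (P.cls p) \<in> LinearCombinations.module_hom class_ring Q.V scalar_module"
      unfolding LinearCombinations.module_hom_def
    proof (safe)
      fix w w' assume "w \<in> carrier Q.V" "w' \<in> carrier Q.V"
      then obtain q q' where q: "q \<in> W'" "q' \<in> W'" "w = P.cls q" "w' = P.cls q'" by auto
      then have "w \<oplus>\<^bsub>Q.V\<^esub> w' = P.cls (q + q')"
        using P.cls_add[of q q'] Q.W_sub by auto
      then show "\<Phi> (P.cls p) (w \<oplus>\<^bsub>Q.V\<^esub> w') = \<Phi> (P.cls p) w \<oplus>\<^bsub>scalar_module\<^esub> \<Phi> (P.cls p) w'"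
        using p q by (simp add: \<Phi> Q.W_add Q.\<phi>_add distrib_left sum.distrib scalar_module_def)
    next
      fix c w assume "w \<in> carrier Q.V"
      then obtain q where q: "q \<in> W'" "w = P.cls q" by auto
      then have "c \<odot>\<^bsub>Q.V\<^esub> w = P.cls (const c * q)"
        using P.cls_smult[of q c] Q.W_sub by auto
      then show "\<Phi> (P.cls p) (c \<odot>\<^bsub>Q.V\<^esub> w) = c \<odot>\<^bsub>scalar_module\<^esub> \<Phi> (P.cls p) w"
        using p q by (simp add: \<Phi> Q.W_const Q.\<phi>_const sum_distrib_left mult.left_commute scalar_module_def)
    qed (simp add: scalar_module_def)
    then show ?thesis using ext by (simp add: dual_space_def)
  qed
  have "\<Phi> \<in> LinearCombinations.module_hom class_ring P.V (dual_space Q.V)"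
    unfolding LinearCombinations.module_hom_def
  proof (safe)
    fix v assume "v \<in> carrier P.V"
    then show "\<Phi> v \<in> carrier (dual_space Q.V)" using form by auto
  next
    fix v v' assume "v \<in> carrier P.V" "v' \<in> carrier P.V"
    then obtain p p' where p: "p \<in> W" "p' \<in> W" "v = P.cls p" "v' = P.cls p'" by auto
    then have "v \<oplus>\<^bsub>P.V\<^esub> v' = P.cls (p + p')"
      using P.cls_add[of p p'] P.W_sub by auto
    moreover have "\<Phi> (P.cls (p + p')) w = (\<Phi> v \<oplus>\<^bsub>dual_space Q.V\<^esub> \<Phi> v') w" if "w \<in> carrier Q.V" for w
      using that p by (auto simp: dual_space_def \<Phi> P.W_add P.\<phi>_add distrib_right sum.distrib)
    ultimately show "\<Phi> (v \<oplus>\<^bsub>P.V\<^esub> v') = \<Phi> v \<oplus>\<^bsub>dual_space Q.V\<^esub> \<Phi> v'"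
      using ext by (intro extensionalityI[of _ "carrier Q.V"]) (auto simp: dual_space_def)
  next
    fix c v assume "v \<in> carrier P.V"
    then obtain p where p: "p \<in> W" "v = P.cls p" by auto
    then have "c \<odot>\<^bsub>P.V\<^esub> v = P.cls (const c * p)"
      using P.cls_smult[of p c] P.W_sub by auto
    moreover have "\<Phi> (P.cls (const c * p)) w = (c \<odot>\<^bsub>dual_space Q.V\<^esub> \<Phi> v) w" if "w \<in> carrier Q.V" for w
      using that p by (auto simp: dual_space_def \<Phi> P.W_const P.\<phi>_const sum_distrib_left mult.assoc)
    ultimately show "\<Phi> (c \<odot>\<^bsub>P.V\<^esub> v) = c \<odot>\<^bsub>dual_space Q.V\<^esub> \<Phi> v"
      using ext by (intro extensionalityI[of _ "carrier Q.V"]) (auto simp: dual_space_def)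
  qed
  moreover have "inj_on \<Phi> (carrier P.V)"
  proof (rule inj_onI)
    fix v v' assume "v \<in> carrier P.V" "v' \<in> carrier P.V" and eq: "\<Phi> v = \<Phi> v'"
    then obtain p p' where p: "p \<in> W" "p' \<in> W" "v = P.cls p" "v' = P.cls p'" by auto
    \<comment> \<open>Pairing with the dual basis vector \<open>b' t\<close> recovers the coordinate
      \<open>\<phi> t\<close>; equal forms thus come from equal classes.\<close>
    have "\<phi> t q = \<Phi> (P.cls q) (P.cls (b' t))" if "q \<in> W" "t \<in> T" for q t
      using that by (simp add: \<Phi> Q.b_W Q.\<phi>_b P.T_fin if_distrib[of "\<lambda>x. _ * x"] cong: if_cong)
    then show "v = v'" using p eq by (simp add: P.cls_eq_iff_\<phi>)
  qed
  moreover have "\<exists>v\<in>carrier P.V. \<Phi> v = \<xi>" if "\<xi> \<in> carrier (dual_space Q.V)" for \<xi>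
  proof -
    have \<xi>: "\<xi> \<in> LinearCombinations.module_hom class_ring Q.V scalar_module" "\<xi> \<in> extensional (carrier Q.V)"
      using that by (simp_all add: dual_space_def)
    have \<xi>_add: "\<xi> (P.cls (q + q')) = \<xi> (P.cls q) + \<xi> (P.cls q')" if "q \<in> W'" "q' \<in> W'" for q q'
      using LinearCombinations.module_hom_add[OF \<xi>(1), of "P.cls q" "P.cls q'"] P.cls_add[of q q'] that subsetD[OF Q.W_sub]
      by (simp add: scalar_module_def)
    have \<xi>_smult: "\<xi> (P.cls (const c * q)) = c * \<xi> (P.cls q)" if "q \<in> W'" for c q
      using LinearCombinations.module_hom_smult[OF \<xi>(1), of c "P.cls q"] P.cls_smult[of q c] that subsetD[OF Q.W_sub]
      by (simp add: scalar_module_def)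
    have \<xi>_sum: "\<xi> (P.cls (\<Sum>i\<in>S. h i)) = (\<Sum>i\<in>S. \<xi> (P.cls (h i)))" if "\<And>i. i \<in> S \<Longrightarrow> h i \<in> W'" for S and h :: "'t \<Rightarrow> _"
      using that
    proof (induction S rule: infinite_finite_induct)
      case (insert x F)
      then show ?case by (simp add: \<xi>_add Q.W_sum)
    qed (use \<xi>_smult[OF Q.W_0, of 0] in simp_all)
    \<comment> \<open>The preimage of \<open>\<xi>\<close>: its coordinate at \<open>t\<close> has
      to be the value of \<open>\<xi>\<close> on \<open>b' t\<close>.\<close>
    define p where "p = (\<Sum>t\<in>T. const (\<xi> (P.cls (b' t))) * b t)"
    have p: "p \<in> W" by (simp add: p_def P.lincomb_W)
    have \<phi>p: "\<phi> t p = \<xi> (P.cls (b' t))" if "t \<in> T" for t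
      using that by (simp add: p_def P.\<phi>_lincomb)
    have "\<Phi> (P.cls p) w = \<xi> w" if w: "w \<in> carrier Q.V" for w
    proof -
      from w obtain q where q: "q \<in> W'" "w = P.cls q" by auto
      \<comment> \<open>The class of \<open>q\<close> is that of the combination given by its
        coordinates, so \<open>\<xi>\<close> is determined by its values on the dual basis.\<close>
      have "w = P.cls (\<Sum>t\<in>T. const (\<psi> t q) * b' t)"
        using q by (simp add: Q.cls_eq_iff_\<phi> Q.lincomb_W Q.\<phi>_lincomb)
      then have "\<xi> w = (\<Sum>t\<in>T. \<psi> t q * \<xi> (P.cls (b' t)))"
        by (simp add: \<xi>_sum \<xi>_smult Q.b_W Q.W_const)
      also have "\<dots> = \<Phi> (P.cls p) w"
        using q by (simp add: \<Phi>[OF p] \<phi>p mult.commute)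
      finally show ?thesis by simp
    qed
    then have "\<Phi> (P.cls p) = \<xi>"
      using ext \<xi>(2) by (intro extensionalityI[of _ "carrier Q.V"]) auto
    then show ?thesis using p by auto
  qed
  ultimately have "linear_iso P.V (dual_space Q.V) \<Phi>"
    using form by (auto simp: linear_iso_def bij_betw_def image_iff) (metis image_eqI)+
  then show ?thesis using \<Phi> \<beta> by auto
qed

end

section \<open>Monomials and contraction\<close>

text \<open>The exponent vector of the square-free monomial \<open>U_F\<close>. On an infinite set
  the sum defaults to 0, hence the finiteness assumptions wherever individual exponents are read
  off.\<close>

definition face_exp :: "nat set \<Rightarrow> (var \<Rightarrow>\<^sub>0 nat)" where
  "face_exp F = (\<Sum>j\<in>F. Poly_Mapping.single (Uvar j) 1)"

definition cone_exp :: "nat \<Rightarrow> nat set \<Rightarrow> (var \<Rightarrow>\<^sub>0 nat)" where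
  "cone_exp i F = Poly_Mapping.single (Xvar i) 1 + face_exp F"

lemma lookup_face_exp:
  "finite F \<Longrightarrow> Poly_Mapping.lookup (face_exp F) v = (case v of Xvar i \<Rightarrow> 0 | Uvar j \<Rightarrow> if j \<in> F then 1 else 0)"
  by (simp add: face_exp_def lookup_sum lookup_single when_def split: var.split)

lemma lookup_cone_exp:
  "finite F \<Longrightarrow> Poly_Mapping.lookup (cone_exp i F) v =
     (case v of Xvar i' \<Rightarrow> if i' = i then 1 else 0 | Uvar j \<Rightarrow> if j \<in> F then 1 else 0)"
  by (simp add: cone_exp_def lookup_face_exp lookup_add lookup_single when_def split: var.split)

lemma keys_face_exp: "finite F \<Longrightarrow> Poly_Mapping.keys (face_exp F) = Uvar ` F"
  by (auto simp: in_keys_iff lookup_face_exp split: var.splits if_splits)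

lemma face_exp_inject: "finite F \<Longrightarrow> finite G \<Longrightarrow> face_exp F = face_exp G \<longleftrightarrow> F = G"
  using keys_face_exp[of F] keys_face_exp[of G] by (metis inj_image_eq_iff injI var.inject(2))

lemma face_exp_Un_disjoint: "finite F \<Longrightarrow> G \<subseteq> F \<Longrightarrow> face_exp (F - G) + face_exp G = face_exp F"
  unfolding face_exp_def by (rule sum.subset_diff[symmetric])

lemma cone_exp_Diff: "finite F \<Longrightarrow> G \<subseteq> F \<Longrightarrow> cone_exp i (F - G) + face_exp G = cone_exp i F"
  by (simp add: cone_exp_def add.assoc face_exp_Un_disjoint)

text \<open>For infinite \<open>F\<close> the product defaults to 1 and the exponent vector to 0, so
  both sides still agree.\<close>

lemma face_monomial_single: "(face_monomial F :: 'k::field mpoly) = Poly_Mapping.single (face_exp F) 1"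
  unfolding face_monomial_def face_exp_def
  by (induction F rule: infinite_finite_induct) (simp_all add: varU_def mult_single)

lemma varX_mult_single: "varX i * Poly_Mapping.single \<alpha> c = (Poly_Mapping.single (Poly_Mapping.single (Xvar i) 1 + \<alpha>) c :: 'k::field mpoly)"
  by (simp add: varX_def mult_single)

lemma varX_face_monomial: "varX i * face_monomial F = (Poly_Mapping.single (cone_exp i F) 1 :: 'k::field mpoly)"
  by (simp add: face_monomial_single varX_mult_single cone_exp_def)

text \<open>Replaces products by a support condition on exponent vectors. Conversely, the powers
  \<open>a j\<close> are read off from \<alpha> at \<open>Uvar j\<close>.\<close>

lemma U_monomials_eq:
  "(U_monomials m :: 'k::field mpoly set) = {Poly_Mapping.single \<alpha> 1 |\<alpha>. Poly_Mapping.keys \<alpha> \<subseteq> Uvar ` {1..m}}"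
proof -
  define e where "e a S = (\<Sum>j\<in>S. Poly_Mapping.single (Uvar j) (a j))" for a :: "nat \<Rightarrow> nat" and S
  have pow: "varU j ^ k = (Poly_Mapping.single (Poly_Mapping.single (Uvar j) k) 1 :: 'k mpoly)" for j k
    by (induction k) (simp_all add: varU_def mult_single single_add[symmetric])
  have e: "(\<Prod>j\<in>S. varU j ^ a j) = (Poly_Mapping.single (e a S) 1 :: 'k mpoly)" for a S
    unfolding e_def by (induction S rule: infinite_finite_induct) (simp_all add: pow mult_single)
  have le: "Poly_Mapping.lookup (e a {1..m}) v = (case v of Xvar i \<Rightarrow> 0 | Uvar j \<Rightarrow> if j \<in> {1..m} then a j else 0)" for a v
    by (simp add: e_def lookup_sum lookup_single when_def split: var.split)
  have sub: "Poly_Mapping.keys (e a {1..m}) \<subseteq> Uvar ` {1..m}" for a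
  proof
    show "v \<in> Uvar ` {1..m}" if "v \<in> Poly_Mapping.keys (e a {1..m})" for v
      using that unfolding in_keys_iff le by (auto split: var.splits if_splits)
  qed
  have rep: "\<alpha> = e (\<lambda>j. Poly_Mapping.lookup \<alpha> (Uvar j)) {1..m}" if "Poly_Mapping.keys \<alpha> \<subseteq> Uvar ` {1..m}" for \<alpha>
  proof (rule poly_mapping_eqI)
    fix v
    have "v \<in> Uvar ` {1..m} \<or> Poly_Mapping.lookup \<alpha> v = 0"
      using that by (meson in_keys_iff subsetD)
    then show "Poly_Mapping.lookup \<alpha> v = Poly_Mapping.lookup (e (\<lambda>j. Poly_Mapping.lookup \<alpha> (Uvar j)) {1..m}) v"
      unfolding le by (cases v) auto
  qed
  show ?thesis
  proof (intro equalityI subsetI)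
    fix q :: "'k mpoly" assume "q \<in> U_monomials m"
    then obtain a where "q = Poly_Mapping.single (e a {1..m}) 1"
      unfolding U_monomials_def e by blast
    then show "q \<in> {Poly_Mapping.single \<alpha> 1 |\<alpha>. Poly_Mapping.keys \<alpha> \<subseteq> Uvar ` {1..m}}"
      using sub[of a] by blast
  next
    fix q :: "'k mpoly" assume "q \<in> {Poly_Mapping.single \<alpha> 1 |\<alpha>. Poly_Mapping.keys \<alpha> \<subseteq> Uvar ` {1..m}}"
    then obtain \<alpha> where q: "q = Poly_Mapping.single \<alpha> 1" "Poly_Mapping.keys \<alpha> \<subseteq> Uvar ` {1..m}"
      by blast
    have "q = Poly_Mapping.single (e (\<lambda>j. Poly_Mapping.lookup \<alpha> (Uvar j)) {1..m}) 1"
      unfolding q(1) by (rule arg_cong[OF rep[OF q(2)]])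
    then show "q \<in> U_monomials m"
      unfolding U_monomials_def e by blast
  qed
qed

section \<open>Bidegrees of monomials\<close>

lemma X_degree_superset: "finite S \<Longrightarrow> Poly_Mapping.keys \<alpha> \<subseteq> S \<Longrightarrow>
    X_degree \<alpha> = (\<Sum>v\<in>S. case v of Xvar i \<Rightarrow> Poly_Mapping.lookup \<alpha> v | Uvar j \<Rightarrow> 0)"
  unfolding X_degree_def by (rule sum.mono_neutral_left) (auto simp: in_keys_iff split: var.split)

lemma U_degree_superset: "finite S \<Longrightarrow> Poly_Mapping.keys \<alpha> \<subseteq> S \<Longrightarrow>
    U_degree \<alpha> = (\<Sum>v\<in>S. case v of Xvar i \<Rightarrow> 0 | Uvar j \<Rightarrow> Poly_Mapping.lookup \<alpha> v)"
  unfolding U_degree_def by (rule sum.mono_neutral_left) (auto simp: in_keys_iff split: var.split)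

lemma X_degree_add: "X_degree (\<alpha> + \<beta>) = X_degree \<alpha> + X_degree \<beta>"
proof -
  let ?S = "Poly_Mapping.keys \<alpha> \<union> Poly_Mapping.keys \<beta>"
  have fin: "finite ?S" by simp
  have "(case v of Xvar i \<Rightarrow> Poly_Mapping.lookup (\<alpha> + \<beta>) v | Uvar j \<Rightarrow> 0) = (case v of Xvar i \<Rightarrow> Poly_Mapping.lookup \<alpha> v | Uvar j \<Rightarrow> 0) + (case v of Xvar i \<Rightarrow> Poly_Mapping.lookup \<beta> v | Uvar j \<Rightarrow> 0)" for v
    by (simp add: lookup_add split: var.split)
  then show ?thesis
    by (simp only: X_degree_superset[OF fin Poly_Mapping.keys_add] X_degree_superset[OF fin Un_upper1]
        X_degree_superset[OF fin Un_upper2] sum.distrib)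
qed

lemma U_degree_add: "U_degree (\<alpha> + \<beta>) = U_degree \<alpha> + U_degree \<beta>"
proof -
  let ?S = "Poly_Mapping.keys \<alpha> \<union> Poly_Mapping.keys \<beta>"
  have fin: "finite ?S" by simp
  have "(case v of Xvar i \<Rightarrow> 0 | Uvar j \<Rightarrow> Poly_Mapping.lookup (\<alpha> + \<beta>) v) = (case v of Xvar i \<Rightarrow> 0 | Uvar j \<Rightarrow> Poly_Mapping.lookup \<alpha> v) + (case v of Xvar i \<Rightarrow> 0 | Uvar j \<Rightarrow> Poly_Mapping.lookup \<beta> v)" for v
    by (simp add: lookup_add split: var.split)
  then show ?thesis
    by (simp only: U_degree_superset[OF fin Poly_Mapping.keys_add] U_degree_superset[OF fin Un_upper1]
        U_degree_superset[OF fin Un_upper2] sum.distrib)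
qed

lemma degree_face_exp: "finite F \<Longrightarrow> X_degree (face_exp F) = 0" "finite F \<Longrightarrow> U_degree (face_exp F) = card F"
  by (simp_all add: X_degree_def U_degree_def keys_face_exp sum.reindex inj_on_def lookup_face_exp)

lemma degree_cone_exp: "finite F \<Longrightarrow> X_degree (cone_exp i F) = 1" "finite F \<Longrightarrow> U_degree (cone_exp i F) = card F"
  by (simp_all add: cone_exp_def X_degree_add U_degree_add degree_face_exp) (simp_all add: X_degree_def U_degree_def)

section \<open>Differentiation of square-free polynomials as contraction\<close>

definition squarefree_poly :: "'k::field mpoly \<Rightarrow> bool" where
  "squarefree_poly f \<longleftrightarrow> (\<forall>\<alpha>\<in>Poly_Mapping.keys f. \<forall>v. Poly_Mapping.lookup \<alpha> v \<le> 1)"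

text \<open>If the shifted coefficient is nonzero, square-freeness forces \<beta> to have exponent 0
  at \<open>v\<close>, so the factor produced by differentiation is 1. Otherwise both sides
  vanish.\<close>

lemma lookup_pd_squarefree:
  assumes "squarefree_poly f"
  shows "Poly_Mapping.lookup (pd v f) \<beta> = Poly_Mapping.lookup f (\<beta> + Poly_Mapping.single v 1)"
proof (cases "Poly_Mapping.lookup f (\<beta> + Poly_Mapping.single v 1) = 0")
  case False
  with assms have "Poly_Mapping.lookup (\<beta> + Poly_Mapping.single v 1) v \<le> 1"
    unfolding squarefree_poly_def by (meson in_keys_iff)
  then show ?thesis by (simp add: lookup_pd lookup_add)
qed (simp add: lookup_pd)

text \<open>Every exponent vector of \<open>h\<close> is dominated by one of \<open>f\<close>. This
  keeps square-freeness available while derivatives are iterated.\<close>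

lemma squarefree_shift:
  assumes "squarefree_poly f" "\<And>\<beta>. Poly_Mapping.lookup h \<beta> = Poly_Mapping.lookup f (\<beta> + \<gamma>)"
  shows "squarefree_poly h"
  unfolding squarefree_poly_def
proof (intro ballI allI)
  fix \<alpha> v assume "\<alpha> \<in> Poly_Mapping.keys h"
  then have "\<alpha> + \<gamma> \<in> Poly_Mapping.keys f" by (simp add: in_keys_iff assms(2))
  then have "Poly_Mapping.lookup (\<alpha> + \<gamma>) v \<le> 1" using assms(1) by (simp add: squarefree_poly_def)
  then show "Poly_Mapping.lookup \<alpha> v \<le> 1" by (simp add: lookup_add)
qed

lemma lookup_pd_pow_squarefree:
  assumes "squarefree_poly f"
  shows "Poly_Mapping.lookup ((pd v ^^ k) f) \<beta> = Poly_Mapping.lookup f (\<beta> + Poly_Mapping.single v k)"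
proof (induction k arbitrary: \<beta>)
  case (Suc k)
  have "squarefree_poly ((pd v ^^ k) f)"
    by (rule squarefree_shift[OF assms Suc])
  then show ?case
    by (simp add: lookup_pd_squarefree Suc add.assoc flip: single_add)
qed simp

lemma lookup_monomial_act_squarefree:
  assumes "squarefree_poly f"
  shows "Poly_Mapping.lookup (monomial_act \<alpha> f) \<beta> = Poly_Mapping.lookup f (\<alpha> + \<beta>)"
proof -
  let ?F = "\<lambda>S. Finite_Set.fold (\<lambda>v. pd v ^^ Poly_Mapping.lookup \<alpha> v) f S"
  have "Poly_Mapping.lookup (?F S) \<beta> =
      Poly_Mapping.lookup f (\<beta> + (\<Sum>v\<in>S. Poly_Mapping.single v (Poly_Mapping.lookup \<alpha> v)))" if "finite S" for S \<beta>
    using that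
  proof (induction S arbitrary: \<beta>)
    case (insert v S)
    have "squarefree_poly (?F S)"
      by (rule squarefree_shift[OF assms insert.IH])
    then show ?case
      using insert by (simp add: lookup_pd_pow_squarefree add_ac)
  qed simp
  \<comment> \<open>The shifts accumulated over the support add up to \<alpha>;
    \<open>mpoly_as_sum\<close> is applied here to the exponent vector itself.\<close>
  from this[of "Poly_Mapping.keys \<alpha>"] show ?thesis
    by (simp add: monomial_act_def mpoly_as_sum[symmetric] add.commute)
qed

lemma lookup_act_squarefree:
  assumes "squarefree_poly f"
  shows "Poly_Mapping.lookup (act p f) \<beta> =
    (\<Sum>\<alpha>\<in>Poly_Mapping.keys p. Poly_Mapping.lookup p \<alpha> * Poly_Mapping.lookup f (\<alpha> + \<beta>))"
  by (simp add: act_def lookup_sum lookup_const_mult lookup_monomial_act_squarefree assms)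

lemma lookup_act_single_squarefree:
  assumes "squarefree_poly f"
  shows "Poly_Mapping.lookup (act (Poly_Mapping.single \<alpha> c) f) \<beta> = c * Poly_Mapping.lookup f (\<alpha> + \<beta>)"
  by (simp add: act_single lookup_const_mult lookup_monomial_act_squarefree assms)

text \<open>The variable with index \<open>i\<close> occurs once in the sum, hence in exactly one
  summand, and the vertices of \<open>H\<close> are distributed between the two summands.\<close>

lemma add_eq_cone_exp_cases:
  assumes "\<alpha> + \<beta> = cone_exp i H" "finite H"
  obtains G where "G \<subseteq> H" "\<beta> = face_exp G" "\<alpha> = cone_exp i (H - G)"
  | G where "G \<subseteq> H" "\<beta> = cone_exp i G" "\<alpha> = face_exp (H - G)"
proof -
  \<comment> \<open>The vertices of \<open>H\<close> that fall to \<beta>; \<alpha> receives the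
    complement by cancellation.\<close>
  define G where "G = {j \<in> H. Poly_Mapping.lookup \<beta> (Uvar j) = 1}"
  have G: "G \<subseteq> H" "finite G" "finite (H - G)" using assms(2) by (auto simp: G_def)
  have l: "Poly_Mapping.lookup \<alpha> v + Poly_Mapping.lookup \<beta> v = Poly_Mapping.lookup (cone_exp i H) v" for v
    using assms(1) by (simp flip: lookup_add)
  have lX: "Poly_Mapping.lookup \<alpha> (Xvar i') + Poly_Mapping.lookup \<beta> (Xvar i') = (if i' = i then 1 else 0)" for i'
    using l[of "Xvar i'"] assms(2) by (simp add: lookup_cone_exp)
  have lU: "Poly_Mapping.lookup \<beta> (Uvar j) = (if j \<in> G then 1 else 0)" for j
    using l[of "Uvar j"] assms(2) by (auto simp: lookup_cone_exp G_def split: if_splits)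
  show thesis
  proof (cases "Poly_Mapping.lookup \<beta> (Xvar i) = 0")
    case True
    then have "Poly_Mapping.lookup \<beta> (Xvar i') = 0" for i'
      using lX[of i'] by (cases "i' = i") auto
    then have "\<beta> = face_exp G"
      by (intro poly_mapping_eqI) (simp add: lookup_face_exp G lU split: var.split)
    with assms cone_exp_Diff[OF assms(2) G(1), of i] have "\<alpha> = cone_exp i (H - G)" by (metis add_right_cancel)
    with that(1) G \<open>\<beta> = face_exp G\<close> show thesis by blast
  next
    case False
    then have "Poly_Mapping.lookup \<beta> (Xvar i') = (if i' = i then 1 else 0)" for i'
      using lX[of i'] by (cases "i' = i") auto
    then have "\<beta> = cone_exp i G"
      by (intro poly_mapping_eqI) (simp add: lookup_cone_exp G lU split: var.split)
    moreover have "face_exp (H - G) + cone_exp i G = cone_exp i H"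
      using face_exp_Un_disjoint[OF assms(2) G(1)] unfolding cone_exp_def by (metis add.left_commute)
    ultimately have "\<alpha> = face_exp (H - G)" using assms(1) by (metis add_right_cancel)
    with that(2) G \<open>\<beta> = cone_exp i G\<close> show thesis by blast
  qed
qed

text \<open>Allows a second contraction to be applied to the result of a first one, as the
  computation of the pairing requires.\<close>

lemma squarefree_act:
  assumes "squarefree_poly f"
  shows "squarefree_poly (act p f)"
  unfolding squarefree_poly_def
proof (intro ballI allI)
  fix \<beta> v assume "\<beta> \<in> Poly_Mapping.keys (act p f)"
  then obtain \<alpha> where "Poly_Mapping.lookup f (\<alpha> + \<beta>) \<noteq> 0"
    unfolding in_keys_iff lookup_act_squarefree[OF assms] by (metis (no_types, lifting) mult_zero_right sum.neutral)
  then have "Poly_Mapping.lookup (\<alpha> + \<beta>) v \<le> 1"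
    using assms unfolding squarefree_poly_def by (meson in_keys_iff)
  then show "Poly_Mapping.lookup \<beta> v \<le> 1" by (simp add: lookup_add)
qed

lemma degree_eq_0:
  assumes "X_degree \<alpha> = 0" "U_degree \<alpha> = 0"
  shows "\<alpha> = 0"
proof (rule poly_mapping_eqI)
  fix v show "Poly_Mapping.lookup \<alpha> v = Poly_Mapping.lookup 0 v"
  proof (cases "v \<in> Poly_Mapping.keys \<alpha>")
    case True
    then show ?thesis
      using assms by (cases v) (auto simp: X_degree_def U_degree_def split: var.splits)
  qed (simp add: in_keys_iff)
qed

text \<open>Splits one variable off a monomial. The exponent of \<open>v\<close> is positive, so the
  truncated subtraction loses nothing.\<close>

lemma keys_split:
  assumes "v \<in> Poly_Mapping.keys \<alpha>"
  obtains \<delta> where "\<alpha> = Poly_Mapping.single v (1::nat) + \<delta>" "Poly_Mapping.keys \<delta> \<subseteq> Poly_Mapping.keys \<alpha>"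
proof
  let ?\<delta> = "\<alpha> - Poly_Mapping.single v 1"
  have l: "Poly_Mapping.lookup \<alpha> v \<noteq> 0" using assms by (simp add: in_keys_iff)
  show "\<alpha> = Poly_Mapping.single v 1 + ?\<delta>"
  proof (rule poly_mapping_eqI)
    fix w show "Poly_Mapping.lookup \<alpha> w = Poly_Mapping.lookup (Poly_Mapping.single v 1 + ?\<delta>) w"
      using l by (cases "w = v") (simp_all add: lookup_add lookup_minus lookup_single)
  qed
  show "Poly_Mapping.keys ?\<delta> \<subseteq> Poly_Mapping.keys \<alpha>"
    by (auto simp: in_keys_iff lookup_minus)
qed

lemma bihom_part_mult:
  assumes p: "p \<in> bihom_part n m i j" and q: "q \<in> bihom_part n m i' j'"
  shows "p * q \<in> bihom_part n m (i + i') (j + j')"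
proof -
  have "int (X_degree \<alpha>) = i + i' \<and> int (U_degree \<alpha>) = j + j'" if "\<alpha> \<in> Poly_Mapping.keys (p * q)" for \<alpha>
  proof -
    from that keys_mult[of p q] obtain \<beta> \<gamma> where
      "\<alpha> = \<beta> + \<gamma>" "\<beta> \<in> Poly_Mapping.keys p" "\<gamma> \<in> Poly_Mapping.keys q" by blast
    with p q show ?thesis by (simp add: bihom_part_def X_degree_add U_degree_add)
  qed
  with p q show ?thesis by (auto simp: bihom_part_def poly_ring_mult)
qed

lemma faces_of_dim_card: "faces_of_dim D (int k - 1) = {F \<in> D. card F = k}"
  by (auto simp: faces_of_dim_def face_dim_def)

lemma minimal_nonface_exists:
  assumes "finite V" "F \<subseteq> V" "F \<notin> D"
  obtains N where "N \<subseteq> F" "minimal_nonface V D N"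
proof -
  let ?S = "{G. G \<subseteq> F \<and> G \<notin> D}"
  have "finite ?S" using assms by (auto intro: finite_subset[of _ "Pow F"] simp: finite_subset)
  moreover have "F \<in> ?S" using assms by simp
  \<comment> \<open>Subsets of \<open>N\<close> are again subsets of \<open>F\<close>, so minimality
    among the non-faces inside \<open>F\<close> is minimality among all of them.\<close>
  ultimately obtain N where N: "N \<in> ?S" "\<forall>G\<in>?S. G \<subseteq> N \<longrightarrow> N = G"
    using finite_has_minimal2[of ?S F] by blast
  then have "minimal_nonface V D N"
    using assms(2) unfolding minimal_nonface_def by blast
  with N(1) that show thesis by blast
qed

lemma eq_face_exp:
  assumes "Poly_Mapping.keys \<alpha> \<subseteq> Uvar ` B" "finite B" "\<And>v. Poly_Mapping.lookup \<alpha> v \<le> 1"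
  obtains F where "F \<subseteq> B" "\<alpha> = face_exp F"
proof
  let ?F = "{j \<in> B. Uvar j \<in> Poly_Mapping.keys \<alpha>}"
  show "\<alpha> = face_exp ?F"
  proof (rule poly_mapping_eqI)
    fix v
    have "v \<in> Poly_Mapping.keys \<alpha> \<Longrightarrow> Poly_Mapping.lookup \<alpha> v = 1"
      using assms(3)[of v] by (simp add: in_keys_iff le_antisym)
    moreover have "v \<in> Poly_Mapping.keys \<alpha> \<Longrightarrow> v \<in> Uvar ` B"
      using assms(1) by blast
    ultimately show "Poly_Mapping.lookup \<alpha> v = Poly_Mapping.lookup (face_exp ?F) v"
      using assms(2) by (cases v; cases "v \<in> Poly_Mapping.keys \<alpha>") (auto simp: lookup_face_exp in_keys_iff)
  qed
qed simp

section \<open>Coordinates modulo the annihilator\<close>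

locale facet_complex =
  fixes n m d :: nat and \<Delta> :: "nat set set" and g :: "nat \<Rightarrow> nat set" and f :: "'k::field mpoly"
  assumes complex: "simplicial_complex {1..m} \<Delta>"
    and homogeneous: "homogeneous_complex \<Delta> (int d - 2)"
    and facets: "bij_betw g {1..n} (facets \<Delta>)"
    and f: "f = facet_poly n g"
begin

lemma face_sub: "F \<in> \<Delta> \<Longrightarrow> F \<subseteq> {1..m}"
  using complex by (auto simp: simplicial_complex_def)

lemma face_finite: "F \<in> \<Delta> \<Longrightarrow> finite F"
  using face_sub finite_subset by blast

lemma \<Delta>_finite: "finite \<Delta>"
  using complex by (auto simp: simplicial_complex_def intro: finite_subset)

lemma subface: "F \<in> \<Delta> \<Longrightarrow> G \<subseteq> F \<Longrightarrow> G \<in> \<Delta>"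
  using complex by (auto simp: simplicial_complex_def)

lemma g_facet: "i \<in> {1..n} \<Longrightarrow> g i \<in> facets \<Delta>"
  using facets by (auto simp: bij_betw_def)

lemma g_face: "i \<in> {1..n} \<Longrightarrow> g i \<in> \<Delta>"
  using g_facet by (auto simp: facets_def)

lemma g_finite: "i \<in> {1..n} \<Longrightarrow> finite (g i)"
  using g_face face_finite by blast

text \<open>The complex is finite, so a face can be enlarged to an inclusion-maximal one, and the
  maximal faces are enumerated by \<open>g\<close>.\<close>

lemma face_in_facet: "F \<in> \<Delta> \<Longrightarrow> \<exists>i\<in>{1..n}. F \<subseteq> g i"
proof -
  assume "F \<in> \<Delta>"
  then obtain M where M: "M \<in> \<Delta>" "F \<subseteq> M" "\<And>G. G \<in> \<Delta> \<Longrightarrow> M \<subseteq> G \<Longrightarrow> M = G"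
    using finite_has_maximal2[OF \<Delta>_finite] by metis
  then have "M \<in> facets \<Delta>" by (auto simp: facets_def)
  then have "M \<in> g ` {1..n}" using facets by (simp add: bij_betw_def)
  then show ?thesis using M(2) by blast
qed

text \<open>Dimension \<open>d - 2\<close> means \<open>d - 1\<close> vertices; the form with
  \<open>Suc\<close> avoids truncated subtraction.\<close>

lemma card_g: "i \<in> {1..n} \<Longrightarrow> Suc (card (g i)) = d"
  using homogeneous g_facet by (fastforce simp: homogeneous_complex_def face_dim_def)

lemma card_face: "F \<in> \<Delta> \<Longrightarrow> Suc (card F) \<le> d"
  using face_in_facet[of F] card_g card_mono[OF g_finite] by fastforce

text \<open>The variable \<open>x_i\<close> occurs only in the term \<open>x_i g_i\<close>, so these
  terms are distinct monomials and no coefficients accumulate.\<close>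

lemma lookup_f: "Poly_Mapping.lookup f \<gamma> = (if \<exists>i\<in>{1..n}. \<gamma> = cone_exp i (g i) then 1 else 0)"
proof -
  have cone_exp_i: "i = j" if ij: "i \<in> {1..n}" "j \<in> {1..n}" "cone_exp i (g i) = cone_exp j (g j)" for i j
  proof -
    have "Poly_Mapping.lookup (cone_exp i (g i)) (Xvar i) = (1::nat)"
      using g_finite[OF ij(1)] by (simp add: lookup_cone_exp)
    then have "Poly_Mapping.lookup (cone_exp j (g j)) (Xvar i) = (1::nat)"
      by (simp only: ij(3))
    then show "i = j"
      using g_finite[OF ij(2)] by (simp add: lookup_cone_exp split: if_splits)
  qed
  have "Poly_Mapping.lookup f \<gamma> = (\<Sum>i\<in>{1..n}. if cone_exp i (g i) = \<gamma> then 1 else 0)"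
    by (subst f) (simp only: facet_poly_def lookup_sum varX_face_monomial lookup_single when_def)
  also have "\<dots> = (if \<exists>i\<in>{1..n}. \<gamma> = cone_exp i (g i) then 1 else 0)"
  proof (cases "\<exists>i\<in>{1..n}. \<gamma> = cone_exp i (g i)")
    case True
    then obtain i where i: "i \<in> {1..n}" "\<gamma> = cone_exp i (g i)" by blast
    have "(\<Sum>j\<in>{1..n}. if cone_exp j (g j) = \<gamma> then 1 else 0) = (\<Sum>j\<in>{1..n}. if j = i then 1 else (0::'k))"
      by (intro sum.cong refl if_cong) (use cone_exp_i[OF _ i(1)] i(2) in blast)
    then show ?thesis using i by auto
  next
    case False
    then have "(\<Sum>i\<in>{1..n}. if cone_exp i (g i) = \<gamma> then 1 else (0::'k)) = (\<Sum>i\<in>{1..n}. 0)"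
      by (intro sum.cong refl if_not_P) blast
    then show ?thesis using False by (simp only: sum.neutral_const if_False)
  qed
  finally show ?thesis .
qed

lemma f_squarefree: "squarefree_poly f"
  unfolding squarefree_poly_def
proof (intro ballI allI)
  fix \<alpha> v assume "\<alpha> \<in> Poly_Mapping.keys f"
  then obtain i where "i \<in> {1..n}" "\<alpha> = cone_exp i (g i)"
    by (auto simp: in_keys_iff lookup_f split: if_splits)
  then show "Poly_Mapping.lookup \<alpha> v \<le> 1"
    using g_finite[of i] by (simp add: lookup_cone_exp split: var.split)
qed

lemmas lookup_act = lookup_act_squarefree[OF f_squarefree]
lemmas lookup_act_single = lookup_act_single_squarefree[OF f_squarefree]

text \<open>A monomial operator that leaves \<beta> from a term of \<open>f\<close> either consumes
  \<open>x_i\<close>, leaving a face, or keeps \<open>x_i\<close> and only removes vertices.\<close>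

lemma lookup_f_addE:
  assumes "Poly_Mapping.lookup f (\<alpha> + \<beta>) \<noteq> 0"
  obtains i G where "i \<in> {1..n}" "G \<subseteq> g i" "\<beta> = face_exp G" "\<alpha> = cone_exp i (g i - G)"
  | i G where "i \<in> {1..n}" "G \<subseteq> g i" "\<beta> = cone_exp i G" "\<alpha> = face_exp (g i - G)"
proof -
  from assms obtain i where i: "i \<in> {1..n}" "\<alpha> + \<beta> = cone_exp i (g i)"
    by (auto simp: lookup_f split: if_splits)
  show thesis
    using add_eq_cone_exp_cases[OF i(2) g_finite[OF i(1)]] that i(1) by metis
qed

text \<open>The monomial \<open>x_i (g_i / F)\<close> can only arise from the term
  \<open>x_i g_i\<close>, and then only by applying \<open>U_F\<close>. So the coefficient of
  \<open>U_F\<close> in \<open>p\<close> is visible in \<open>p(f)\<close>.\<close>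

lemma lookup_act_cone_exp:
  assumes i: "i \<in> {1..n}" and F: "F \<subseteq> g i"
  shows "Poly_Mapping.lookup (act p f) (cone_exp i (g i - F)) = Poly_Mapping.lookup p (face_exp F)"
proof -
  have fin: "finite (g i)" "finite F" using i F g_finite finite_subset by blast+
  have "Poly_Mapping.lookup f (\<alpha> + cone_exp i (g i - F)) = (if \<alpha> = face_exp F then 1 else 0)" for \<alpha>
  proof -
    have e: "face_exp F + cone_exp i (g i - F) = cone_exp i (g i)"
      using cone_exp_Diff[OF fin(1) F] by (simp add: add.commute)
    have "\<alpha> = face_exp F" if j: "j \<in> {1..n}" "\<alpha> + cone_exp i (g i - F) = cone_exp j (g j)" for j
    proof -
      \<comment> \<open>The left side is at least 1 because of the second summand, which forces
        \<open>j = i\<close>.\<close>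
      have "Poly_Mapping.lookup (\<alpha> + cone_exp i (g i - F)) (Xvar i) = (if i = j then 1 else 0)"
        using j g_finite[OF j(1)] by (simp add: lookup_cone_exp)
      then have "j = i" using fin by (auto simp: lookup_add lookup_cone_exp split: if_splits)
      with j e show ?thesis by (metis add_right_cancel)
    qed
    with e i have "(\<exists>j\<in>{1..n}. \<alpha> + cone_exp i (g i - F) = cone_exp j (g j)) \<longleftrightarrow> \<alpha> = face_exp F" by blast
    then show ?thesis unfolding lookup_f by (simp only:)
  qed
  then show ?thesis
    by (auto simp: lookup_act if_distrib[of "\<lambda>x. _ * x"] in_keys_iff cong: if_cong)
qed

text \<open>\<open>X_i\<close> kills every term except \<open>x_i g_i\<close>, and the remaining
  factor removes the complement of \<open>G\<close> from \<open>g_i\<close>.\<close>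

lemma act_single_cone_exp:
  assumes "i \<in> {1..n}" "G \<subseteq> g i"
  shows "act (Poly_Mapping.single (cone_exp i (g i - G)) 1) f = face_monomial G"
proof (rule poly_mapping_eqI)
  fix \<beta>
  have fin: "finite (g i)" using assms g_finite by blast
  have e: "cone_exp i (g i - G) + face_exp G = cone_exp i (g i)"
    by (rule cone_exp_Diff[OF fin assms(2)])
  have "\<beta> = face_exp G" if j: "j \<in> {1..n}" "cone_exp i (g i - G) + \<beta> = cone_exp j (g j)" for j
  proof -
    have "Poly_Mapping.lookup (cone_exp i (g i - G) + \<beta>) (Xvar i) = (if i = j then 1 else 0)"
      using j g_finite[OF j(1)] by (simp add: lookup_cone_exp)
    then have "j = i" using fin by (auto simp: lookup_add lookup_cone_exp split: if_splits)
    with j e show ?thesis by (metis add_left_cancel)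
  qed
  with e assms(1) have "(\<exists>j\<in>{1..n}. cone_exp i (g i - G) + \<beta> = cone_exp j (g j)) \<longleftrightarrow> face_exp G = \<beta>" by blast
  then show "Poly_Mapping.lookup (act (Poly_Mapping.single (cone_exp i (g i - G)) 1) f) \<beta> =
      Poly_Mapping.lookup (face_monomial G) \<beta>"
    unfolding lookup_act_single lookup_f face_monomial_single lookup_single when_def by simp
qed

section \<open>The linear forms that cut out the annihilator\<close>

abbreviation "I \<equiv> Ann n m f"

sublocale poly_ideal n m I
  by (rule poly_ideal.intro) (rule Ann_ideal)

text \<open>A disjoint sum as index type, because each face contributes two forms:
  \<open>Inl\<close> for X-degree 0 and \<open>Inr\<close> for X-degree 1.\<close>

definition coord :: "nat set + nat set \<Rightarrow> 'k mpoly \<Rightarrow> 'k" where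
  "coord t p = (case t of Inl F \<Rightarrow> Poly_Mapping.lookup p (face_exp F) | Inr G \<Rightarrow> Poly_Mapping.lookup (act p f) (face_exp G))"

lemma coord_Inl: "coord (Inl F) p = Poly_Mapping.lookup p (face_exp F)"
  and coord_Inr: "coord (Inr G) p = Poly_Mapping.lookup (act p f) (face_exp G)"
  by (simp_all add: coord_def)

lemma coord_add: "coord t (p + q) = coord t p + coord t q"
  by (simp add: coord_def lookup_add act_add_left split: sum.split)

lemma coord_const: "coord t (const c * p) = c * coord t p"
  by (simp add: coord_def lookup_const_mult act_mult act_const split: sum.split)

lemma coord_0: "coord t 0 = 0"
  using coord_const[of t 0 0] by simp

lemma coord_sum: "coord t (\<Sum>i\<in>S. p i) = (\<Sum>i\<in>S. coord t (p i))"
  by (induction S rule: infinite_finite_induct) (simp_all add: coord_0 coord_add)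

lemma coord_diff: "coord t (p - q) = coord t p - coord t q"
  using coord_add[of t "p - q" q] by (simp add: eq_diff_eq)

text \<open>The only bidegree in which \<open>coord t\<close> can be nonzero. On faces the truncated
  subtraction is exact, since they have at most \<open>d - 1\<close> elements.\<close>

definition bideg :: "nat set + nat set \<Rightarrow> nat \<times> nat" where
  "bideg t = (case t of Inl F \<Rightarrow> (0, card F) | Inr G \<Rightarrow> (1, d - 1 - card G))"

definition mdeg :: "(var \<Rightarrow>\<^sub>0 nat) \<Rightarrow> nat \<times> nat" where
  "mdeg \<alpha> = (X_degree \<alpha>, U_degree \<alpha>)"

definition T :: "(nat set + nat set) set" where
  "T = \<Delta> <+> \<Delta>"

lemma T_finite: "finite T"
  by (simp add: T_def \<Delta>_finite)

lemma mem_Ann_iff: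
  assumes "p \<in> carrier R"
  shows "p \<in> I \<longleftrightarrow> (\<forall>t\<in>T. coord t p = 0)"
proof
  assume "p \<in> I"
  then have 0: "act p f = 0" by (simp add: Ann_def)
  have "Poly_Mapping.lookup p (face_exp F) = 0" if F: "F \<in> \<Delta>" for F
  proof -
    from face_in_facet[OF F] obtain i where "i \<in> {1..n}" "F \<subseteq> g i" by blast
    from lookup_act_cone_exp[OF this, of p] 0 show ?thesis by simp
  qed
  then show "\<forall>t\<in>T. coord t p = 0" by (auto simp: T_def coord_Inl coord_Inr 0)
next
  assume "\<forall>t\<in>T. coord t p = 0"
  then have c: "Poly_Mapping.lookup p (face_exp F) = 0" "Poly_Mapping.lookup (act p f) (face_exp F) = 0" if "F \<in> \<Delta>" for F
    using that by (auto simp: T_def coord_Inl coord_Inr dest: bspec[of _ _ "Inl F"] bspec[of _ _ "Inr F"])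
  have "act p f = 0"
  proof (rule poly_mapping_eqI, rule ccontr)
    fix \<beta> assume *: "Poly_Mapping.lookup (act p f) \<beta> \<noteq> Poly_Mapping.lookup 0 \<beta>"
    then obtain \<alpha> where "Poly_Mapping.lookup f (\<alpha> + \<beta>) \<noteq> 0"
      unfolding lookup_act by (metis (no_types, lifting) lookup_zero mult_zero_right sum.neutral)
    then show False
    proof (cases rule: lookup_f_addE)
      case (1 i G)
      then show ?thesis using c(2)[of G] * subface[OF g_face] by simp
    next
      case (2 i G)
      \<comment> \<open>The coefficient of \<open>x_i G\<close> in \<open>p(f)\<close> is that of
        \<open>U_F\<close> in \<open>p\<close> for the complement \<open>F = g i - G\<close>, so the
        \<open>Inl\<close> coordinates control it.\<close>
      then have "g i - (g i - G) = G" by blast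
      then show ?thesis
        using lookup_act_cone_exp[OF 2(1), of "g i - G" p] 2 c(1)[of "g i - G"] * subface[OF g_face] by simp
    qed
  qed
  then show "p \<in> I" using assms by (simp add: Ann_def)
qed

lemma mdeg_face_exp: "finite F \<Longrightarrow> mdeg (face_exp F) = (0, card F)"
  by (simp add: mdeg_def degree_face_exp)

text \<open>All terms of \<open>f\<close> have bidegree \<open>(1, d - 1)\<close>. A monomial
  contributing to the coefficient of \<open>G\<close> in \<open>p(f)\<close> therefore has the
  bidegree complementary to that of \<open>G\<close>.\<close>

lemma coord_eq_0:
  assumes t: "t \<in> T" and p: "\<And>\<alpha>. \<alpha> \<in> Poly_Mapping.keys p \<Longrightarrow> mdeg \<alpha> \<noteq> bideg t"
  shows "coord t p = 0"
proof (cases t)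
  case (Inl F)
  with t have "finite F" by (auto simp: T_def face_finite)
  then have "face_exp F \<notin> Poly_Mapping.keys p" using p[of "face_exp F"] Inl by (auto simp: bideg_def mdeg_face_exp)
  then show ?thesis by (simp add: Inl coord_Inl in_keys_iff)
next
  case (Inr G)
  with t have G: "G \<in> \<Delta>" by (auto simp: T_def)
  have "Poly_Mapping.lookup f (\<alpha> + face_exp G) = 0" if \<alpha>: "\<alpha> \<in> Poly_Mapping.keys p" for \<alpha>
  proof (rule ccontr)
    assume "Poly_Mapping.lookup f (\<alpha> + face_exp G) \<noteq> 0"
    then obtain i where i: "i \<in> {1..n}" "\<alpha> + face_exp G = cone_exp i (g i)"
      by (auto simp: lookup_f split: if_splits)
    then have "X_degree (\<alpha> + face_exp G) = 1" "U_degree (\<alpha> + face_exp G) = card (g i)"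
      by (simp_all add: degree_cone_exp g_finite)
    then have "mdeg \<alpha> = bideg t"
      using card_g[OF i(1)] by (simp add: X_degree_add U_degree_add degree_face_exp face_finite[OF G] mdeg_def bideg_def Inr)
    with p[OF \<alpha>] show False by simp
  qed
  then show ?thesis by (simp add: Inr coord_Inr lookup_act)
qed

definition represents :: "nat set + nat set \<Rightarrow> 'k mpoly \<Rightarrow> bool" where
  "represents t p = (case t of Inl F \<Rightarrow> p = face_monomial F
     | Inr G \<Rightarrow> \<exists>i\<in>{1..n}. \<exists>P\<in>U_monomials m. p = varX i * P \<and> act p f = face_monomial G)"

lemma represents_monomial:
  assumes t: "t \<in> T" and p: "represents t p"
  obtains \<alpha> where "p = Poly_Mapping.single \<alpha> 1" "mdeg \<alpha> = bideg t" "p \<in> carrier R"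
proof (cases t)
  case (Inl F)
  with t have F: "F \<in> \<Delta>" by (auto simp: T_def)
  then have "Poly_Mapping.single (face_exp F) 1 \<in> carrier R"
    using face_sub[of F] by (auto simp: in_poly_ring_iff keys_face_exp face_finite)
  with that[of "face_exp F"] Inl p face_finite[OF F] show thesis
    by (simp add: represents_def face_monomial_single mdeg_face_exp bideg_def)
next
  case (Inr G)
  with t have G: "G \<in> \<Delta>" by (auto simp: T_def)
  from p Inr obtain i \<alpha> where i: "i \<in> {1..n}" and \<alpha>: "Poly_Mapping.keys \<alpha> \<subseteq> Uvar ` {1..m}"
    and p: "p = Poly_Mapping.single (Poly_Mapping.single (Xvar i) 1 + \<alpha>) 1" and a: "act p f = face_monomial G"
    by (auto simp: represents_def U_monomials_eq varX_mult_single)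
  let ?\<gamma> = "Poly_Mapping.single (Xvar i) 1 + \<alpha>"
  have "Poly_Mapping.keys ?\<gamma> \<subseteq> Xvar ` {1..n} \<union> Uvar ` {1..m}"
    using Poly_Mapping.keys_add[of "Poly_Mapping.single (Xvar i) 1" \<alpha>] \<alpha> i by auto
  then have "p \<in> carrier R" by (simp add: in_poly_ring_iff p)
  \<comment> \<open>No computation of degrees is needed: in a wrong bidegree the coefficient of
    \<open>G\<close> in \<open>p(f)\<close> would vanish, whereas it is 1.\<close>
  moreover have "mdeg ?\<gamma> = bideg t"
  proof (rule ccontr)
    assume "mdeg ?\<gamma> \<noteq> bideg t"
    then have "coord t p = 0" using t p by (intro coord_eq_0) auto
    with a show False by (simp add: Inr coord_Inr face_monomial_single)
  qed
  ultimately show thesis using that p by blast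
qed

text \<open>Biorthogonality. Between the two kinds of indices it holds because the X-degrees differ;
  within one kind, because distinct faces have distinct exponent vectors.\<close>

lemma coord_represents:
  assumes s: "s \<in> T" and t: "t \<in> T" and p: "represents t p"
  shows "coord s p = (if s = t then 1 else 0)"
proof -
  obtain \<alpha> where \<alpha>: "p = Poly_Mapping.single \<alpha> 1" "mdeg \<alpha> = bideg t"
    using represents_monomial[OF t p] .
  show ?thesis
  proof (cases s)
    case (Inl F)
    show ?thesis
    proof (cases t)
      case (Inl F')
      then show ?thesis
        using \<open>s = Inl F\<close> s t p by (auto simp: coord_Inl represents_def face_monomial_single lookup_single when_def T_def
          face_exp_inject face_finite)
    next
      case (Inr G)
      then show ?thesis
        using \<open>s = Inl F\<close> \<alpha> by (subst coord_eq_0[OF s]) (auto simp: bideg_def)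
    qed
  next
    case (Inr F)
    show ?thesis
    proof (cases t)
      case (Inl F')
      then show ?thesis
        using \<open>s = Inr F\<close> \<alpha> by (subst coord_eq_0[OF s]) (auto simp: bideg_def)
    next
      case (Inr G)
      then have "act p f = face_monomial G" using p by (auto simp: represents_def)
      then show ?thesis
        using \<open>s = Inr F\<close> Inr s t by (auto simp: coord_Inr face_monomial_single lookup_single when_def T_def
          face_exp_inject face_finite)
    qed
  qed
qed

lemma represents_face_monomial: "represents (Inl F) (face_monomial F)"
  by (simp add: represents_def)

lemma face_monomial_U_monomials: "F \<subseteq> {1..m} \<Longrightarrow> face_monomial F \<in> U_monomials m"
proof -
  assume F: "F \<subseteq> {1..m}"
  then have "Poly_Mapping.keys (face_exp F) \<subseteq> Uvar ` {1..m}"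
    by (subst keys_face_exp) (auto intro: finite_subset)
  then show ?thesis unfolding U_monomials_eq face_monomial_single by blast
qed

lemma represents_complement:
  assumes "i \<in> {1..n}" "G \<subseteq> g i"
  shows "represents (Inr G) (varX i * face_monomial (g i - G))"
proof -
  have "face_monomial (g i - G) \<in> U_monomials m"
    using face_sub[OF g_face[OF assms(1)]] by (intro face_monomial_U_monomials) blast
  then show ?thesis
    using assms(1) act_single_cone_exp[OF assms] unfolding represents_def varX_face_monomial[symmetric] by auto
qed

section \<open>Coordinates on the graded pieces\<close>

definition piece :: "(nat \<times> nat \<Rightarrow> bool) \<Rightarrow> 'k mpoly set" where
  "piece D = {p \<in> carrier R. \<forall>\<alpha>\<in>Poly_Mapping.keys p. D (mdeg \<alpha>)}"

lemma quot_subspace_piece: "quot_subspace n m I (piece D)"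
proof
  show "p + q \<in> piece D" if "p \<in> piece D" "q \<in> piece D" for p q
    using that Poly_Mapping.keys_add[of p q] by (auto simp: piece_def poly_ring_add)
  show "const c * p \<in> piece D" if "p \<in> piece D" for c p
    using that const_mult_keys[of c p] by (auto simp: piece_def poly_ring_mult poly_ring_const)
qed (auto simp: piece_def poly_ring_0)

text \<open>On \<open>piece D\<close> all forms whose bidegree violates \<open>D\<close> vanish, so
  the remaining ones suffice to test membership in \<open>I\<close>. The map \<open>h\<close> lets a
  piece be indexed directly by faces.\<close>

lemma quot_coords_piece:
  assumes D: "\<And>t. t \<in> T \<Longrightarrow> D (bideg t) \<longleftrightarrow> t \<in> h ` S"
    and h: "inj_on h S" "h ` S \<subseteq> T"
    and b: "\<And>s. s \<in> S \<Longrightarrow> represents (h s) (b s)"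
  shows "quot_coords n m I (piece D) S b (\<lambda>s. coord (h s))"
proof -
  interpret quot_subspace n m I "piece D" by (rule quot_subspace_piece)
  show ?thesis
  proof
    show "finite S" using finite_subset[OF h(2) T_finite] finite_imageD h(1) by blast
    show "b s \<in> piece D" if s: "s \<in> S" for s
    proof -
      have hs: "h s \<in> T" using h(2) s by blast
      obtain \<alpha> where "b s = Poly_Mapping.single \<alpha> 1" "mdeg \<alpha> = bideg (h s)" "b s \<in> carrier R"
        using represents_monomial[OF hs b[OF s]] .
      then show ?thesis using D[OF hs] s by (auto simp: piece_def)
    qed
    show "coord (h s) (b t) = (if s = t then 1 else 0)" if "s \<in> S" "t \<in> S" for s t
    proof -
      have "h s \<in> T" "h t \<in> T" using h(2) that by blast+
      then show ?thesis using coord_represents[OF _ _ b] that by (simp add: inj_on_eq_iff[OF h(1)])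
    qed
    show "p \<in> I \<longleftrightarrow> (\<forall>s\<in>S. coord (h s) p = 0)" if p: "p \<in> piece D" for p
    proof -
      have "coord t p = 0" if "t \<in> T" "t \<notin> h ` S" for t
        using that p D[OF that(1)] by (intro coord_eq_0) (auto simp: piece_def)
      then have "(\<forall>t\<in>T. coord t p = 0) \<longleftrightarrow> (\<forall>s\<in>S. coord (h s) p = 0)" using h(2) by blast
      then show ?thesis using p mem_Ann_iff[of p] by (auto simp: piece_def)
    qed
  qed (simp_all add: coord_add coord_const)
qed

text \<open>One fixed representative per index; the facet around \<open>G\<close> comes from a
  choice operator and is meaningful when \<open>G\<close> is a face.\<close>

definition std :: "nat set + nat set \<Rightarrow> 'k mpoly" where
  "std t = (case t of Inl F \<Rightarrow> face_monomial F
     | Inr G \<Rightarrow> let i = SOME i. i \<in> {1..n} \<and> G \<subseteq> g i in varX i * face_monomial (g i - G))"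

lemma std_Inl: "std (Inl F) = face_monomial F"
  by (simp add: std_def)

lemma std_Inr:
  assumes "G \<in> \<Delta>"
  obtains i where "i \<in> {1..n}" "G \<subseteq> g i" "std (Inr G) = varX i * face_monomial (g i - G)"
proof -
  let ?i = "SOME i. i \<in> {1..n} \<and> G \<subseteq> g i"
  have "\<exists>i. i \<in> {1..n} \<and> G \<subseteq> g i" using face_in_facet[OF assms] by blast
  then have "?i \<in> {1..n} \<and> G \<subseteq> g ?i" by (rule someI_ex)
  then show thesis by (intro that[of ?i]) (simp_all only: std_def sum.case Let_def)
qed

lemma represents_std: "t \<in> T \<Longrightarrow> represents t (std t)"
proof (cases t)
  case (Inr G)
  assume "t \<in> T"
  then have "G \<in> \<Delta>" using Inr by (auto simp: T_def)
  then show ?thesis using Inr by (metis std_Inr represents_complement)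
qed (simp add: std_Inl represents_face_monomial)

lemma bihom_part_piece: "bihom_part n m i j = piece (\<lambda>(x, u). int x = i \<and> int u = j)"
  by (simp add: bihom_part_def piece_def mdeg_def)

lemma hom_part_piece: "hom_part n m k = piece (\<lambda>(x, u). int (x + u) = k)"
  by (simp add: hom_part_def piece_def mdeg_def)

lemma carrier_piece: "carrier R = piece (\<lambda>_. True)"
  by (simp add: piece_def)

lemma faces_of_dim_dual:
  "k \<le> d \<Longrightarrow> faces_of_dim \<Delta> (int d - int k - 1) = {F \<in> \<Delta>. card F = d - k}"
  using faces_of_dim_card[of \<Delta> "d - k"] by (simp add: of_nat_diff)

lemma T_cases:
  assumes "t \<in> T"
  obtains F where "t = Inl F" "F \<in> \<Delta>" "bideg t = (0, card F)"
  | G where "t = Inr G" "G \<in> \<Delta>" "bideg t = (1, d - 1 - card G)"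
  using assms by (auto simp: T_def bideg_def)

lemma coords_U:
  "quot_coords n m I (bihom_part n m 0 (int k)) (faces_of_dim \<Delta> (int k - 1)) face_monomial (\<lambda>F. coord (Inl F))"
  unfolding bihom_part_piece faces_of_dim_card
proof (rule quot_coords_piece)
  fix t assume "t \<in> T"
  then show "(case bideg t of (x, u) \<Rightarrow> int x = 0 \<and> int u = int k) \<longleftrightarrow> t \<in> Inl ` {F \<in> \<Delta>. card F = k}"
    by (cases rule: T_cases) auto
qed (auto simp: T_def represents_face_monomial)

lemma coords_X:
  assumes k: "k \<le> d"
    and b: "\<And>G. G \<in> faces_of_dim \<Delta> (int d - int k - 1) \<Longrightarrow> represents (Inr G) (b G)"
  shows "quot_coords n m I (bihom_part n m 1 (int k - 1)) (faces_of_dim \<Delta> (int d - int k - 1)) b (\<lambda>G. coord (Inr G))"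
  unfolding bihom_part_piece
proof (rule quot_coords_piece)
  fix t assume "t \<in> T"
  then show "(case bideg t of (x, u) \<Rightarrow> int x = 1 \<and> int u = int k - 1) \<longleftrightarrow>
      t \<in> Inr ` faces_of_dim \<Delta> (int d - int k - 1)"
  proof (cases rule: T_cases)
    case (2 G)
    \<comment> \<open>For \<open>k = 0\<close> both sides are false: the left asks for a negative
      degree, and no face has \<open>d\<close> vertices.\<close>
    have "(int (d - 1 - card G) = int k - 1) \<longleftrightarrow> card G = d - k"
      using card_face[OF 2(2)] k by linarith
    then show ?thesis using 2 k by (auto simp: faces_of_dim_dual)
  qed auto
qed (auto simp: T_def b faces_of_dim_dual k)

lemma coords_total:
  assumes k: "k \<le> d"
  shows "quot_coords n m I (hom_part n m (int k))
    (faces_of_dim \<Delta> (int k - 1) <+> faces_of_dim \<Delta> (int d - int k - 1)) std coord"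
  unfolding hom_part_piece
proof (rule quot_coords_piece[where h = "\<lambda>t. t"])
  fix t assume "t \<in> T"
  then show "(case bideg t of (x, u) \<Rightarrow> int (x + u) = int k) \<longleftrightarrow>
      t \<in> (\<lambda>t. t) ` (faces_of_dim \<Delta> (int k - 1) <+> faces_of_dim \<Delta> (int d - int k - 1))"
  proof (cases rule: T_cases)
    case (2 G)
    have "(int (1 + (d - 1 - card G)) = int k) \<longleftrightarrow> card G = d - k"
      using card_face[OF 2(2)] k by linarith
    then show ?thesis using 2 k by (auto simp: faces_of_dim_dual)
  qed (auto simp: faces_of_dim_card)
qed (auto simp: T_def faces_of_dim_dual faces_of_dim_card k intro!: represents_std)

lemma coords_all: "quot_coords n m I (carrier R) T std coord"
  unfolding carrier_piece
  by (rule quot_coords_piece[where h = "\<lambda>t. t"]) (auto simp: represents_std)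

section \<open>The pairing of complementary bidegrees\<close>

lemma pairing_eq:
  assumes k: "k \<le> d"
    and p: "p \<in> bihom_part n m 0 (int d - int k)" and q: "q \<in> bihom_part n m 1 (int k - 1)"
  shows "Poly_Mapping.lookup (act (p * q) f) 0 =
    (\<Sum>F\<in>faces_of_dim \<Delta> (int d - int k - 1). coord (Inl F) p * coord (Inr F) q)"
proof -
  let ?S = "faces_of_dim \<Delta> (int d - int k - 1)"
  have dk: "int (d - k) = int d - int k" using k by simp
  interpret P: quot_coords n m I "bihom_part n m 0 (int d - int k)" ?S face_monomial "\<lambda>F. coord (Inl F)"
    using coords_U[of "d - k"] unfolding dk .
  \<comment> \<open>The combination of face monomials in the class of \<open>p\<close>; replacing
    \<open>p\<close> by it changes \<open>p * q\<close> only by an element of the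
    annihilator.\<close>
  define p' where "p' = (\<Sum>F\<in>?S. const (coord (Inl F) p) * face_monomial F)"
  have p': "p' \<in> bihom_part n m 0 (int d - int k)" unfolding p'_def by (rule P.lincomb_W)
  have "cls p = cls p'"
    by (subst P.cls_eq_iff_\<phi>[OF p p']) (simp add: p'_def P.\<phi>_lincomb)
  moreover have c: "p \<in> carrier R" "p' \<in> carrier R" "q \<in> carrier R"
    using p p' q by (simp_all add: bihom_part_def)
  ultimately have "p - p' \<in> I" by (simp add: cls_eq_iff)
  then have "q * (p - p') \<in> I" using c by (rule_tac I_mult)
  then have "act (p * q - p' * q) f = 0" by (simp add: Ann_def algebra_simps)
  then have "act (p * q) f = act (p' * q) f"
    using act_add_left[of "p * q - p' * q" "p' * q" f] by simp
  also have "act (p' * q) f = act p' (act q f)" by (rule act_mult)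
  also have "Poly_Mapping.lookup (act p' (act q f)) 0 =
      (\<Sum>F\<in>?S. coord (Inl F) p * Poly_Mapping.lookup (act (face_monomial F) (act q f)) 0)"
    by (simp add: p'_def act_sum_left lookup_sum act_mult[of "const _"] act_const lookup_const_mult)
  \<comment> \<open>Contracting the square-free polynomial \<open>q(f)\<close> by \<open>U_F\<close>
    moves its coefficient at \<open>F\<close> to the constant term.\<close>
  also have "\<dots> = (\<Sum>F\<in>?S. coord (Inl F) p * coord (Inr F) q)"
    by (simp add: face_monomial_single coord_Inr lookup_act_single_squarefree[OF squarefree_act[OF f_squarefree]])
  finally show ?thesis .
qed

text \<open>An operator of the same bidegree as \<open>f\<close> leaves only a constant, so
  evaluation at \<open>f\<close> is scalar-valued here.\<close>

lemma act_top_degree: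
  assumes r: "r \<in> bihom_part n m 1 (int d - 1)"
  shows "const (Poly_Mapping.lookup (act r f) 0) = act r f"
proof (rule poly_mapping_eqI)
  fix \<beta>
  have "Poly_Mapping.lookup (act r f) \<beta> = 0" if \<beta>: "\<beta> \<noteq> 0"
  proof -
    have "Poly_Mapping.lookup f (\<alpha> + \<beta>) = 0" if \<alpha>: "\<alpha> \<in> Poly_Mapping.keys r" for \<alpha>
    proof (rule ccontr)
      assume "Poly_Mapping.lookup f (\<alpha> + \<beta>) \<noteq> 0"
      then obtain i where i: "i \<in> {1..n}" "\<alpha> + \<beta> = cone_exp i (g i)"
        by (auto simp: lookup_f split: if_splits)
      then have "X_degree (\<alpha> + \<beta>) = 1" "U_degree (\<alpha> + \<beta>) = card (g i)"
        by (simp_all add: degree_cone_exp g_finite)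
      with card_g[OF i(1)] r \<alpha> have "X_degree \<beta> = 0" "U_degree \<beta> = 0"
        by (auto simp: bihom_part_def X_degree_add U_degree_add)
      with \<beta> show False by (simp add: degree_eq_0)
    qed
    then show ?thesis by (simp add: lookup_act)
  qed
  then show "Poly_Mapping.lookup (const (Poly_Mapping.lookup (act r f) 0)) \<beta> = Poly_Mapping.lookup (act r f) \<beta>"
    by (cases "\<beta> = 0") (simp_all add: const_def lookup_single when_def)
qed

lemma duality:
  assumes k: "k \<le> d"
  shows "\<exists>\<Phi>. linear_iso (bigraded_piece n m I 0 (int d - int k)) (dual_space (bigraded_piece n m I 1 (int k - 1))) \<Phi>
    \<and> (\<forall>p\<in>bihom_part n m 0 (int d - int k). \<forall>q\<in>bihom_part n m 1 (int k - 1).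
         const (\<Phi> (cls p) (cls q)) = act (p * q) f)"
proof -
  let ?S = "faces_of_dim \<Delta> (int d - int k - 1)"
  have dk: "int (d - k) = int d - int k" using k by simp
  interpret P: quot_coords n m I "bihom_part n m 0 (int d - int k)" ?S face_monomial "\<lambda>F. coord (Inl F)"
    using coords_U[of "d - k"] unfolding dk .
  interpret Q: quot_coords n m I "bihom_part n m 1 (int k - 1)" ?S "\<lambda>G. std (Inr G)" "\<lambda>G. coord (Inr G)"
    by (rule coords_X[OF k]) (auto intro!: represents_std simp: faces_of_dim_def T_def)
  interpret quot_pairing n m I "bihom_part n m 0 (int d - int k)" ?S face_monomial "\<lambda>F. coord (Inl F)"
    "bihom_part n m 1 (int k - 1)" "\<lambda>G. std (Inr G)" "\<lambda>G. coord (Inr G)"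
    "\<lambda>p q. Poly_Mapping.lookup (act (p * q) f) 0"
    by unfold_locales (rule pairing_eq[OF k])
  have "const (Poly_Mapping.lookup (act (p * q) f) 0) = act (p * q) f"
    if "p \<in> bihom_part n m 0 (int d - int k)" "q \<in> bihom_part n m 1 (int k - 1)" for p q
    using bihom_part_mult[OF that] by (intro act_top_degree) simp
  then show ?thesis
    using perfect_pairing unfolding bigraded_piece_def by (metis (lifting))
qed

lemma dim_total:
  assumes k: "k \<le> d"
  shows "vectorspace.dim class_ring (graded_piece n m I (int k)) = face_number \<Delta> k + face_number \<Delta> (d - k)"
proof -
  interpret quot_coords n m I "hom_part n m (int k)"
    "faces_of_dim \<Delta> (int k - 1) <+> faces_of_dim \<Delta> (int d - int k - 1)" std coord
    by (rule coords_total[OF k])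
  have "finite (faces_of_dim \<Delta> j)" for j
    by (simp add: faces_of_dim_def \<Delta>_finite)
  then show ?thesis
    using dim k by (simp add: graded_piece_def face_number_def card_Plus of_nat_diff)
qed

section \<open>The decomposition by total degree\<close>

definition component :: "(nat \<times> nat \<Rightarrow> bool) \<Rightarrow> 'k mpoly \<Rightarrow> 'k mpoly" where
  "component D p = (\<Sum>\<alpha>\<in>{\<alpha> \<in> Poly_Mapping.keys p. D (mdeg \<alpha>)}. Poly_Mapping.single \<alpha> (Poly_Mapping.lookup p \<alpha>))"

lemma lookup_component: "Poly_Mapping.lookup (component D p) \<alpha> = (if D (mdeg \<alpha>) then Poly_Mapping.lookup p \<alpha> else 0)"
  by (auto simp: component_def lookup_sum lookup_single when_def in_keys_iff)

lemma component_piece: "p \<in> carrier R \<Longrightarrow> component D p \<in> piece D"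
  by (auto simp: piece_def in_poly_ring_iff in_keys_iff lookup_component split: if_splits)

text \<open>What \<open>component D\<close> discards contains no monomial of bidegree
  \<open>bideg t\<close>, so the form does not see it.\<close>

lemma coord_component: "t \<in> T \<Longrightarrow> D (bideg t) \<Longrightarrow> coord t (component D p) = coord t p"
proof -
  assume t: "t \<in> T" "D (bideg t)"
  have "mdeg \<alpha> \<noteq> bideg t" if "\<alpha> \<in> Poly_Mapping.keys (p - component D p)" for \<alpha>
    using that t(2) by (auto simp: in_keys_iff lookup_minus lookup_component)
  then have "coord t (p - component D p) = 0" by (rule coord_eq_0[OF t(1)])
  then show ?thesis by (simp add: coord_diff)
qed

text \<open>Faces have at most \<open>d - 1\<close> vertices. This bound is what stops the grading
  of the algebra at \<open>d\<close>.\<close>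

lemma total_bideg:
  assumes "t \<in> T"
  shows "fst (bideg t) + snd (bideg t) \<le> d"
  using assms
proof (cases rule: T_cases)
  case (1 F)
  then show ?thesis using card_face[of F] by simp
next
  case (2 G)
  then show ?thesis using card_face[of G] by simp
qed

lemma cls_eq_iff_coord: "p \<in> carrier R \<Longrightarrow> q \<in> carrier R \<Longrightarrow> cls p = cls q \<longleftrightarrow> (\<forall>t\<in>T. coord t p = coord t q)"
  by (simp add: cls_eq_iff mem_Ann_iff poly_ring_diff coord_diff)

text \<open>Each form sees a single total degree, so the equation expressing a class as a sum of
  homogeneous classes decouples into one equation per degree. Existence and uniqueness both follow
  from that equivalence.\<close>

lemma direct_sum: "internal_direct_sum A {..d} (\<lambda>k. carrier (graded_piece n m I (int k)))"
proof -
  interpret W: quot_coords n m I "carrier R" T std coord by (rule coords_all)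
  have WA: "W.V = A" using carrier_A by simp
  define D where "D k = (\<lambda>(x, u). int (x + u) = int k)" for k :: nat
  have hom: "hom_part n m (int k) = piece (D k)" for k by (simp add: D_def hom_part_piece)
  have sub: "piece D' \<subseteq> carrier R" for D' by (auto simp: piece_def)
  have carr: "carrier (graded_piece n m I (int k)) = cls ` piece (D k)" for k
    by (simp add: graded_piece_def hom)
  have key: "cls p = finsum A (\<lambda>k. cls (q k)) {..d} \<longleftrightarrow> (\<forall>k\<in>{..d}. cls (q k) = cls (component (D k) p))"
    if p: "p \<in> carrier R" and q: "\<And>k. k \<in> {..d} \<Longrightarrow> q k \<in> piece (D k)" for p q
  proof -
    have qR: "q k \<in> carrier R" if "k \<in> {..d}" for k using q[OF that] sub by blast
    have cR: "component (D k) p \<in> carrier R" for k using component_piece[OF p] sub by blast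
    have "finsum A (\<lambda>k. cls (q k)) {..d} = cls (\<Sum>k\<in>{..d}. q k)"
      using W.finsum_cls[of "{..d}" q] qR unfolding WA by blast
    then have "cls p = finsum A (\<lambda>k. cls (q k)) {..d} \<longleftrightarrow> (\<forall>t\<in>T. coord t p = (\<Sum>k\<in>{..d}. coord t (q k)))"
      using p poly_ring_sum[of "{..d}" q, OF qR] by (simp add: cls_eq_iff_coord coord_sum)
    \<comment> \<open>Only the summand in the total degree of \<open>t\<close> survives, and this
      degree lies in \<open>{..d}\<close> by \<open>total_bideg\<close>.\<close>
    also have "\<dots> \<longleftrightarrow> (\<forall>t\<in>T. coord t p = coord t (q (fst (bideg t) + snd (bideg t))))"
    proof (intro ball_cong refl arg_cong[where f = "(=) _"])
      fix t assume t: "t \<in> T"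
      let ?k = "fst (bideg t) + snd (bideg t)"
      have "coord t (q k) = 0" if "k \<in> {..d}" "k \<noteq> ?k" for k
        using that q[of k] by (intro coord_eq_0 t) (auto simp: piece_def D_def case_prod_unfold)
      then have "(\<Sum>k\<in>{..d}. coord t (q k)) = (\<Sum>k\<in>{?k}. coord t (q k))"
        using total_bideg[OF t] by (intro sum.mono_neutral_right) auto
      then show "(\<Sum>k\<in>{..d}. coord t (q k)) = coord t (q ?k)" by simp
    qed
    also have "\<dots> \<longleftrightarrow> (\<forall>k\<in>{..d}. \<forall>t\<in>T. coord t (q k) = coord t (component (D k) p))"
    proof safe
      fix k t assume k: "k \<le> d" and t: "t \<in> T"
        and eq: "\<forall>t\<in>T. coord t p = coord t (q (fst (bideg t) + snd (bideg t)))"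
      show "coord t (q k) = coord t (component (D k) p)"
      proof (cases "k = fst (bideg t) + snd (bideg t)")
        case True
        then have "D k (bideg t)" by (simp add: D_def case_prod_unfold)
        then show ?thesis using coord_component[OF t] eq t True by simp
      next
        case False
        then have "coord t r = 0" if "r \<in> piece (D k)" for r
          using that by (intro coord_eq_0 t) (auto simp: piece_def D_def case_prod_unfold)
        then show ?thesis using q[of k] k component_piece[OF p] by simp
      qed
    next
      fix t assume t: "t \<in> T" and eq: "\<forall>k\<in>{..d}. \<forall>t\<in>T. coord t (q k) = coord t (component (D k) p)"
      let ?k = "fst (bideg t) + snd (bideg t)"
      have "D ?k (bideg t)" by (simp add: D_def case_prod_unfold)
      then show "coord t p = coord t (q ?k)"
        using eq t coord_component[OF t, of "D ?k"] total_bideg[OF t] by simp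
    qed
    also have "\<dots> \<longleftrightarrow> (\<forall>k\<in>{..d}. cls (q k) = cls (component (D k) p))"
      using qR cR by (simp add: cls_eq_iff_coord)
    finally show ?thesis .
  qed
  have closed: "cls ` piece (D k) \<subseteq> carrier A" for k
    unfolding carrier_A using sub by blast
  show ?thesis
    unfolding internal_direct_sum_def carr
  proof (intro conjI ballI closed)
    fix v assume "v \<in> carrier A"
    then obtain p where p: "p \<in> carrier R" "v = cls p" unfolding carrier_A by blast
    let ?c = "\<lambda>k\<in>{..d}. cls (component (D k) p)"
    \<comment> \<open>Values outside \<open>{..d}\<close> do not affect the sum; this links the
      extensional families of the definition with the plain ones in \<open>key\<close>.\<close>
    have fc: "finsum A c {..d} = finsum A c' {..d}" if "\<And>k. k \<in> {..d} \<Longrightarrow> c k = c' k" "\<And>k. k \<in> {..d} \<Longrightarrow> c' k \<in> carrier A" for c c'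
      using that W.V.finsum_cong'[of "{..d}" "{..d}" c' c] unfolding WA by blast
    show "\<exists>!c. c \<in> (\<Pi>\<^sub>E k\<in>{..d}. cls ` piece (D k)) \<and> v = finsum A c {..d}"
    proof (rule ex1I)
      have "finsum A ?c {..d} = finsum A (\<lambda>k. cls (component (D k) p)) {..d}"
        using closed component_piece[OF p(1)] by (intro fc) auto
      then show "?c \<in> (\<Pi>\<^sub>E k\<in>{..d}. cls ` piece (D k)) \<and> v = finsum A ?c {..d}"
        using key[OF p(1), of "\<lambda>k. component (D k) p"] component_piece[OF p(1)] p(2) by auto
    next
      fix c assume c: "c \<in> (\<Pi>\<^sub>E k\<in>{..d}. cls ` piece (D k)) \<and> v = finsum A c {..d}"
      then have "\<forall>k\<in>{..d}. \<exists>q. q \<in> piece (D k) \<and> c k = cls q" by (auto simp: PiE_def Pi_def image_iff)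
      then obtain q where q: "\<And>k. k \<in> {..d} \<Longrightarrow> q k \<in> piece (D k)" "\<And>k. k \<in> {..d} \<Longrightarrow> c k = cls (q k)" by metis
      have "finsum A c {..d} = finsum A (\<lambda>k. cls (q k)) {..d}"
        using closed q by (intro fc) auto
      then have "cls (q k) = cls (component (D k) p)" if "k \<in> {..d}" for k
        using key[OF p(1) q(1)] c p(2) that by auto
      then have "c k = ?c k" if "k \<in> {..d}" for k using q(2) that by simp
      then show "c = ?c" using c by (intro extensionalityI[of _ "{..d}"]) (auto simp: PiE_def)
    qed
  qed
qed

lemma total_above:
  assumes "d < k"
  shows "carrier (graded_piece n m I (int k)) = {\<zero>\<^bsub>A\<^esub>}"
proof -
  interpret quot_subspace n m I "hom_part n m (int k)" unfolding hom_part_piece by (rule quot_subspace_piece)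
  have "cls p = \<zero>\<^bsub>A\<^esub>" if p: "p \<in> hom_part n m (int k)" for p
  proof -
    have "coord t p = 0" if "t \<in> T" for t
      using total_bideg[OF that] assms p
      by (intro coord_eq_0 that) (auto simp: hom_part_def mdeg_def dest!: sym[of _ "bideg t"])
    then show ?thesis using p W_sub by (subst cls_eq_zero_iff) (auto simp: mem_Ann_iff)
  qed
  moreover have "\<zero>\<^bsub>A\<^esub> \<in> cls ` hom_part n m (int k)"
    unfolding cls_zero using W_0 by (rule imageI)
  ultimately have "cls ` hom_part n m (int k) = {\<zero>\<^bsub>A\<^esub>}"
    by blast
  then show ?thesis by (simp add: graded_piece_def)
qed

lemma total_split:
  assumes k: "k \<le> d"
  shows "carrier (graded_piece n m I (int k)) =
      carrier (bigraded_piece n m I 0 (int k)) <+>\<^bsub>A\<^esub> carrier (bigraded_piece n m I 1 (int k - 1))" (is ?sum)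
    and "carrier (bigraded_piece n m I 0 (int k)) \<inter> carrier (bigraded_piece n m I 1 (int k - 1)) = {\<zero>\<^bsub>A\<^esub>}" (is ?int)
proof -
  let ?U = "faces_of_dim \<Delta> (int k - 1)" and ?X = "faces_of_dim \<Delta> (int d - int k - 1)"
  interpret W: quot_coords n m I "hom_part n m (int k)" "?U <+> ?X" std coord by (rule coords_total[OF k])
  interpret P: quot_coords n m I "bihom_part n m 0 (int k)" ?U face_monomial "\<lambda>F. coord (Inl F)" by (rule coords_U)
  interpret Q: quot_coords n m I "bihom_part n m 1 (int k - 1)" ?X "\<lambda>G. std (Inr G)" "\<lambda>G. coord (Inr G)"
    by (rule coords_X[OF k]) (auto intro!: represents_std simp: faces_of_dim_def T_def)
  have sub: "bihom_part n m 0 (int k) \<subseteq> hom_part n m (int k)" "bihom_part n m 1 (int k - 1) \<subseteq> hom_part n m (int k)"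
    by (auto simp: bihom_part_def hom_part_def)
  have add: "cls p \<oplus>\<^bsub>A\<^esub> cls q = cls (p + q)" if "p \<in> hom_part n m (int k)" "q \<in> hom_part n m (int k)" for p q
    using that W.W_sub by (intro cls_add) auto
  have split: "\<exists>p\<in>bihom_part n m 0 (int k). \<exists>q\<in>bihom_part n m 1 (int k - 1). cls r = cls p \<oplus>\<^bsub>A\<^esub> cls q"
    if r: "r \<in> hom_part n m (int k)" for r
  proof -
    \<comment> \<open>The expansion of \<open>r\<close> in the standard monomials, separated into
      the \<open>Inl\<close> and the \<open>Inr\<close> part.\<close>
    let ?p = "\<Sum>F\<in>?U. const (coord (Inl F) r) * face_monomial F"
    let ?q = "\<Sum>G\<in>?X. const (coord (Inr G) r) * std (Inr G)"
    have "?p + ?q = (\<Sum>t\<in>?U <+> ?X. const (coord t r) * std t)"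
      using P.T_fin Q.T_fin by (simp add: sum.Plus std_Inl)
    then have "cls r = cls (?p + ?q)"
      using W.cls_eq_iff_\<phi>[OF r W.lincomb_W] W.\<phi>_lincomb by simp
    moreover have "?p \<in> hom_part n m (int k)" "?q \<in> hom_part n m (int k)"
      using sub P.lincomb_W Q.lincomb_W by (meson subsetD)+
    ultimately have "cls r = cls ?p \<oplus>\<^bsub>A\<^esub> cls ?q" by (simp only: add)
    then show ?thesis by (intro bexI[of _ ?p] bexI[of _ ?q] P.lincomb_W Q.lincomb_W)
  qed
  have "cls ` hom_part n m (int k) \<subseteq> cls ` bihom_part n m 0 (int k) <+>\<^bsub>A\<^esub> cls ` bihom_part n m 1 (int k - 1)"
  proof
    fix v assume "v \<in> cls ` hom_part n m (int k)"
    then obtain r where r: "r \<in> hom_part n m (int k)" "v = cls r" by blast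
    then show "v \<in> cls ` bihom_part n m 0 (int k) <+>\<^bsub>A\<^esub> cls ` bihom_part n m 1 (int k - 1)"
      using split[OF r(1)] unfolding set_add_def' by blast
  qed
  moreover have "cls ` bihom_part n m 0 (int k) <+>\<^bsub>A\<^esub> cls ` bihom_part n m 1 (int k - 1) \<subseteq> cls ` hom_part n m (int k)"
  proof
    fix v assume "v \<in> cls ` bihom_part n m 0 (int k) <+>\<^bsub>A\<^esub> cls ` bihom_part n m 1 (int k - 1)"
    then obtain p q where pq: "p \<in> bihom_part n m 0 (int k)" "q \<in> bihom_part n m 1 (int k - 1)" "v = cls p \<oplus>\<^bsub>A\<^esub> cls q"
      unfolding set_add_def' by blast
    then have "p \<in> hom_part n m (int k)" "q \<in> hom_part n m (int k)" using sub by blast+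
    then show "v \<in> cls ` hom_part n m (int k)" unfolding pq(3) by (simp add: add W.W_add)
  qed
  ultimately show ?sum
    by (simp add: graded_piece_def bigraded_piece_def)
  \<comment> \<open>The \<open>Inr\<close> coordinates vanish on \<open>p\<close> and the
    \<open>Inl\<close> coordinates on \<open>q\<close>, so a common class has no nonzero
    coordinate.\<close>
  have "cls p = \<zero>\<^bsub>A\<^esub>" if p: "p \<in> bihom_part n m 0 (int k)" and q: "q \<in> bihom_part n m 1 (int k - 1)" and eq: "cls p = cls q" for p q
  proof -
    have pq: "p \<in> carrier R" "q \<in> carrier R" using p q by (simp_all add: bihom_part_def)
    have "coord t p = 0" if t: "t \<in> T" for t
      using t
    proof (cases rule: T_cases)
      case (1 F)
      have "coord t q = 0" using q 1 by (intro coord_eq_0 t) (auto simp: bihom_part_def mdeg_def)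
      then show ?thesis using eq t pq by (simp add: cls_eq_iff_coord)
    next
      case (2 G)
      then show ?thesis using p by (intro coord_eq_0 t) (auto simp: bihom_part_def mdeg_def)
    qed
    then show ?thesis using pq by (simp add: cls_eq_zero_iff mem_Ann_iff)
  qed
  moreover have "\<zero>\<^bsub>A\<^esub> \<in> cls ` bihom_part n m 0 (int k)" "\<zero>\<^bsub>A\<^esub> \<in> cls ` bihom_part n m 1 (int k - 1)"
    using P.W_0 Q.W_0 by (auto simp: cls_zero)
  ultimately have "cls ` bihom_part n m 0 (int k) \<inter> cls ` bihom_part n m 1 (int k - 1) = {\<zero>\<^bsub>A\<^esub>}"
    by (intro equalityI subsetI) blast+
  then show ?int
    by (simp add: bigraded_piece_def)
qed

section \<open>Generators of the annihilator\<close>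

definition gens :: "'k mpoly set" where
  "gens = gens_squares n m \<union> gens_nonfaces m \<Delta> I \<union> gens_nonsubfaces n m g \<union> gens_binomials n m g"

text \<open>By \<open>lookup_f_addE\<close>, a monomial that does not kill \<open>f\<close> is
  \<open>U_F\<close> for a face \<open>F\<close> or \<open>X_i U_G\<close> with \<open>G\<close>
  inside \<open>g_i\<close>.\<close>

lemma single_in_I:
  assumes "Poly_Mapping.keys \<alpha> \<subseteq> Xvar ` {1..n} \<union> Uvar ` {1..m}"
    and "\<And>F. F \<in> \<Delta> \<Longrightarrow> \<alpha> \<noteq> face_exp F"
    and "\<And>i G. i \<in> {1..n} \<Longrightarrow> G \<subseteq> g i \<Longrightarrow> \<alpha> \<noteq> cone_exp i G"
  shows "Poly_Mapping.single \<alpha> 1 \<in> I"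
proof -
  have "act (Poly_Mapping.single \<alpha> 1) f = 0"
  proof (rule poly_mapping_eqI, rule ccontr)
    fix \<beta> assume "Poly_Mapping.lookup (act (Poly_Mapping.single \<alpha> 1) f) \<beta> \<noteq> Poly_Mapping.lookup 0 \<beta>"
    then have "Poly_Mapping.lookup f (\<alpha> + \<beta>) \<noteq> 0" by (simp add: lookup_act_single)
    then show False
    proof (cases rule: lookup_f_addE)
      case (1 i G)
      then show ?thesis using assms(3)[of i "g i - G"] by simp
    next
      case (2 i G)
      then show ?thesis using assms(2)[of "g i - G"] subface[OF g_face, of i "g i - G"] by simp
    qed
  qed
  then show ?thesis using poly_ring_single[OF assms(1)] by (simp add: Ann_def)
qed

lemma gens_sub: "gens \<subseteq> I"
  unfolding gens_def
proof (intro Un_least)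
  have keysX: "Poly_Mapping.keys (Poly_Mapping.single (Xvar i) 1 + \<alpha>) \<subseteq> Xvar ` {1..n} \<union> Uvar ` {1..m}"
    if "i \<in> {1..n}" "Poly_Mapping.keys \<alpha> \<subseteq> Xvar ` {1..n} \<union> Uvar ` {1..m}" for i and \<alpha> :: "var \<Rightarrow>\<^sub>0 nat"
    using that Poly_Mapping.keys_add[of "Poly_Mapping.single (Xvar i) (1::nat)" \<alpha>] by auto
  show "gens_squares n m \<subseteq> I"
  proof
    fix p :: "'k mpoly" assume "p \<in> gens_squares n m"
    then consider i j where "i \<in> {1..n}" "j \<in> {1..n}" "p = varX i * varX j" | j where "j \<in> {1..m}" "p = varU j ^ 2"
      by (auto simp: gens_squares_def)
    then show "p \<in> I"
    proof cases
      case (1 i j)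
      let ?\<alpha> = "Poly_Mapping.single (Xvar i) 1 + Poly_Mapping.single (Xvar j) (1::nat)"
      \<comment> \<open>X-degree 2 rules out both exceptional kinds of monomials, whose X-degrees
        are 0 and 1.\<close>
      have X2: "X_degree ?\<alpha> = 2" by (simp add: X_degree_add) (simp add: X_degree_def)
      have "Poly_Mapping.single ?\<alpha> 1 \<in> I"
      proof (rule single_in_I)
        show "Poly_Mapping.keys ?\<alpha> \<subseteq> Xvar ` {1..n} \<union> Uvar ` {1..m}"
          using 1 by (intro keysX) auto
        show "?\<alpha> \<noteq> face_exp F" if "F \<in> \<Delta>" for F
        proof
          assume "?\<alpha> = face_exp F"
          then have "X_degree (face_exp F) = 2" using X2 by (simp only:)
          then show False by (simp add: degree_face_exp face_finite[OF that])
        qed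
        show "?\<alpha> \<noteq> cone_exp i' G" if "i' \<in> {1..n}" "G \<subseteq> g i'" for i' G
        proof
          assume "?\<alpha> = cone_exp i' G"
          then have "X_degree (cone_exp i' G) = 2" using X2 by (simp only:)
          then show False by (simp add: degree_cone_exp finite_subset[OF that(2) g_finite[OF that(1)]])
        qed
      qed
      then show ?thesis by (simp add: 1 varX_def mult_single)
    next
      case (2 j)
      let ?\<alpha> = "Poly_Mapping.single (Uvar j) (2::nat)"
      have "Poly_Mapping.single ?\<alpha> 1 \<in> I"
      proof (rule single_in_I)
        show "Poly_Mapping.keys ?\<alpha> \<subseteq> Xvar ` {1..n} \<union> Uvar ` {1..m}"
          using 2 by simp
        show "?\<alpha> \<noteq> face_exp F" if "F \<in> \<Delta>" for F
        proof
          assume "?\<alpha> = face_exp F"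
          then have "Poly_Mapping.lookup (face_exp F) (Uvar j) = 2" by (metis lookup_single_eq)
          then show False by (simp add: lookup_face_exp face_finite[OF that] split: if_splits)
        qed
        show "?\<alpha> \<noteq> cone_exp i' G" if "i' \<in> {1..n}" "G \<subseteq> g i'" for i' G
        proof
          assume "?\<alpha> = cone_exp i' G"
          then have "Poly_Mapping.lookup (cone_exp i' G) (Uvar j) = 2" by (metis lookup_single_eq)
          then show False by (simp add: lookup_cone_exp finite_subset[OF that(2) g_finite[OF that(1)]] split: if_splits)
        qed
      qed
      then show ?thesis by (simp only: 2(2) varU_def power2_eq_square mult_single single_add[symmetric] one_add_one mult_1)
    qed
  qed
  show "gens_nonfaces m \<Delta> I \<subseteq> I" by (auto simp: gens_nonfaces_def)
  show "gens_nonsubfaces n m g \<subseteq> I"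
  proof
    fix p :: "'k mpoly" assume "p \<in> gens_nonsubfaces n m g"
    then obtain i \<alpha> where i: "i \<in> {1..n}" and \<alpha>: "Poly_Mapping.keys \<alpha> \<subseteq> Uvar ` {1..m}"
      and p: "p = varX i * Poly_Mapping.single \<alpha> 1"
      and nS: "\<not> (\<exists>S. S \<subseteq> g i \<and> Poly_Mapping.single \<alpha> (1::'k) = face_monomial S)"
      unfolding gens_nonsubfaces_def U_monomials_eq by blast
    let ?\<gamma> = "Poly_Mapping.single (Xvar i) 1 + \<alpha>"
    have "Poly_Mapping.single ?\<gamma> 1 \<in> I"
    proof (rule single_in_I)
      show "Poly_Mapping.keys ?\<gamma> \<subseteq> Xvar ` {1..n} \<union> Uvar ` {1..m}"
        using i \<alpha> by (intro keysX) auto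
      have l: "Poly_Mapping.lookup ?\<gamma> (Xvar i) \<noteq> 0" by (simp add: lookup_add)
      show "?\<gamma> \<noteq> face_exp F" if "F \<in> \<Delta>" for F
        using l by (auto simp: lookup_face_exp face_finite[OF that])
      show "?\<gamma> \<noteq> cone_exp i' G" if G: "i' \<in> {1..n}" "G \<subseteq> g i'" for i' G
      proof
        assume eq: "?\<gamma> = cone_exp i' G"
        then have "i' = i" using l by (auto simp: lookup_cone_exp finite_subset[OF G(2) g_finite[OF G(1)]] split: if_splits)
        with eq have "\<alpha> = face_exp G" unfolding cone_exp_def by (metis add_left_cancel)
        with nS G \<open>i' = i\<close> show False by (auto simp: face_monomial_single)
      qed
    qed
    then show "p \<in> I" by (simp add: p varX_mult_single)
  qed
  show "gens_binomials n m g \<subseteq> I"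
  proof
    fix p :: "'k mpoly" assume "p \<in> gens_binomials n m g"
    then obtain i j S and P P' :: "'k mpoly" where ij: "i \<in> {1..n}" "j \<in> {1..n}" and P: "P \<in> U_monomials m" "P' \<in> U_monomials m"
      and S: "S \<subseteq> g i \<inter> g j" and eq: "face_monomial (g i) = P * face_monomial S" "face_monomial (g j) = P' * face_monomial S"
      and p: "p = varX i * P - varX j * P'"
      unfolding gens_binomials_def by blast
    \<comment> \<open>Cancelling the monomial of \<open>S\<close> identifies the cofactor as the
      complement of \<open>S\<close> in the facet.\<close>
    have fm: "Q = face_monomial (g l - S)"
      if l: "l \<in> {1..n}" "S \<subseteq> g l" and Q: "Q \<in> U_monomials m" "face_monomial (g l) = Q * (face_monomial S :: 'k mpoly)" for l Q
    proof -
      from Q(1) obtain \<alpha> where \<alpha>: "Q = Poly_Mapping.single \<alpha> 1" by (auto simp: U_monomials_eq)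
      have "Poly_Mapping.single (face_exp (g l)) (1::'k) = Poly_Mapping.single (\<alpha> + face_exp S) 1"
        using Q(2) by (simp add: \<alpha> face_monomial_single mult_single)
      then have "face_exp (g l) = \<alpha> + face_exp S"
        by (metis keys_single one_neq_zero singleton_inject)
      with face_exp_Un_disjoint[OF g_finite[OF l(1)] l(2)] have "\<alpha> = face_exp (g l - S)"
        by (metis add_right_cancel)
      then show ?thesis by (simp add: \<alpha> face_monomial_single)
    qed
    \<comment> \<open>Both terms of the binomial send \<open>f\<close> to the same face
      \<open>S\<close>, hence their difference annihilates \<open>f\<close>.\<close>
    have "represents (Inr S) (varX i * P)" "represents (Inr S) (varX j * P')"
      using represents_complement[of i S] represents_complement[of j S] ij S fm[OF ij(1) _ P(1) eq(1)] fm[OF ij(2) _ P(2) eq(2)]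
      by auto
    moreover have "Inr S \<in> T" using subface[OF g_face[OF ij(1)], of S] S by (auto simp: T_def)
    ultimately have "varX i * P \<in> carrier R" "varX j * P' \<in> carrier R" "act (varX i * P) f = act (varX j * P') f"
      using represents_monomial[of "Inr S"] by (metis, metis, auto simp: represents_def)
    moreover have "act (varX i * P - varX j * P') f = act (varX i * P) f - act (varX j * P') f"
      using act_add_left[of "varX i * P - varX j * P'" "varX j * P'" f] by simp
    ultimately show "p \<in> I"
      unfolding p by (simp add: Ann_def poly_ring_diff)
  qed
qed

text \<open>Repeated variables \<open>U_j\<close> and products of two \<open>X_i\<close> are caught
  by the quadratic generators, non-faces by a minimal non-face dividing them, and \<open>X_i\<close>
  times a non-subface is itself a generator. Only monomials of the two dual kinds remain.\<close>

lemma monomial_cases: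
  assumes J: "poly_ideal n m J" "gens \<subseteq> J"
    and \<alpha>: "Poly_Mapping.keys \<alpha> \<subseteq> Xvar ` {1..n} \<union> Uvar ` {1..m}"
  obtains "Poly_Mapping.single \<alpha> 1 \<in> J"
  | F where "F \<in> \<Delta>" "\<alpha> = face_exp F"
  | i G where "i \<in> {1..n}" "G \<subseteq> g i" "\<alpha> = cone_exp i (g i - G)"
proof (cases "Poly_Mapping.keys \<alpha> \<subseteq> Uvar ` {1..m}")
  case U: True
  interpret J: poly_ideal n m J by (rule J(1))
  show thesis
  proof (cases "\<exists>v. Poly_Mapping.lookup \<alpha> v > 1")
    case True
    then obtain v where v: "Poly_Mapping.lookup \<alpha> v > 1" by blast
    then have "v \<in> Poly_Mapping.keys \<alpha>" by (simp add: in_keys_iff)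
    from keys_split[OF this] obtain \<delta> where \<delta>: "\<alpha> = Poly_Mapping.single v 1 + \<delta>" "Poly_Mapping.keys \<delta> \<subseteq> Poly_Mapping.keys \<alpha>" .
    \<comment> \<open>The exponent of \<open>v\<close> exceeds 1, so \<open>v\<close> can be split
      off a second time and its square divides the monomial.\<close>
    with v have "v \<in> Poly_Mapping.keys \<delta>" by (simp add: in_keys_iff lookup_add)
    from keys_split[OF this] obtain \<delta>' where \<delta>': "\<delta> = Poly_Mapping.single v 1 + \<delta>'" "Poly_Mapping.keys \<delta>' \<subseteq> Poly_Mapping.keys \<delta>" .
    from \<open>v \<in> Poly_Mapping.keys \<alpha>\<close> U obtain j where j: "j \<in> {1..m}" "v = Uvar j" by blast
    then have "varU j ^ 2 \<in> J" using J(2) unfolding gens_def gens_squares_def by blast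
    then have "Poly_Mapping.single (Poly_Mapping.single v 1 + Poly_Mapping.single v 1) 1 \<in> J"
      by (simp add: j(2) varU_def power2_eq_square mult_single)
    from J.I_single_add[OF this, of \<delta>'] \<delta> \<delta>' \<alpha> have "Poly_Mapping.single \<alpha> 1 \<in> J"
      by (simp add: add.assoc)
    with that(1) show thesis .
  next
    case False
    then obtain F where F: "F \<subseteq> {1..m}" "\<alpha> = face_exp F"
      using eq_face_exp[OF U] by (metis finite_atLeastAtMost not_le)
    show thesis
    proof (cases "F \<in> \<Delta>")
      case False
      obtain N where N: "N \<subseteq> F" "minimal_nonface {1..m} \<Delta> N"
        using minimal_nonface_exists[OF _ F(1) False] by blast
      have fin: "finite F" "finite N" using F N finite_subset[of _ "{1..m}"] by auto
      \<comment> \<open>Membership in the annihilator is part of the definition of this family of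
        generators, so it has to be verified for the minimal non-face.\<close>
      have "Poly_Mapping.single (face_exp N) 1 \<in> I"
      proof (rule single_in_I)
        show "Poly_Mapping.keys (face_exp N) \<subseteq> Xvar ` {1..n} \<union> Uvar ` {1..m}"
          unfolding keys_face_exp[OF fin(2)] using F N by blast
        show "face_exp N \<noteq> face_exp H" if "H \<in> \<Delta>" for H
          using N(2) that face_finite fin by (auto simp: face_exp_inject minimal_nonface_def)
        show "face_exp N \<noteq> cone_exp i G" if "i \<in> {1..n}" "G \<subseteq> g i" for i G
        proof
          assume "face_exp N = cone_exp i G"
          then have "X_degree (face_exp N) = X_degree (cone_exp i G)" by (simp only:)
          then show False using fin finite_subset[OF that(2) g_finite[OF that(1)]] by (simp add: degree_face_exp degree_cone_exp)
        qed
      qed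
      then have "face_monomial N \<in> gens"
        using N(2) unfolding gens_def gens_nonfaces_def face_monomial_single by blast
      then have "Poly_Mapping.single (face_exp N) 1 \<in> J" using J(2) by (auto simp: face_monomial_single)
      then have "Poly_Mapping.single (face_exp N + face_exp (F - N)) 1 \<in> J"
        using \<alpha> F fin by (intro J.I_single_add) (auto simp: keys_face_exp)
      then have "Poly_Mapping.single \<alpha> 1 \<in> J"
        using face_exp_Un_disjoint[OF fin(1) N(1)] by (simp add: F(2) add.commute)
      with that(1) show thesis .
    qed (use that(2) F in blast)
  qed
next
  case False
  interpret J: poly_ideal n m J by (rule J(1))
  from False \<alpha> obtain i where i: "i \<in> {1..n}" "Xvar i \<in> Poly_Mapping.keys \<alpha>" by blast
  from keys_split[OF i(2)] obtain \<delta> where \<delta>: "\<alpha> = Poly_Mapping.single (Xvar i) 1 + \<delta>" "Poly_Mapping.keys \<delta> \<subseteq> Poly_Mapping.keys \<alpha>" .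
  show thesis
  proof (cases "Poly_Mapping.keys \<delta> \<subseteq> Uvar ` {1..m}")
    case True
    show thesis
    proof (cases "\<exists>S. S \<subseteq> g i \<and> \<delta> = face_exp S")
      case True
      then obtain S where S: "S \<subseteq> g i" "\<delta> = face_exp S" by blast
      \<comment> \<open>The face represented by \<open>X_i U_S\<close> is \<open>g i - S\<close>, so
        \<open>S\<close> is rewritten as its complement to match the third case.\<close>
      then have "g i - (g i - S) = S" by blast
      then have "\<alpha> = cone_exp i (g i - (g i - S))" using \<delta> S by (simp add: cone_exp_def)
      with that(3)[OF i(1), of "g i - S"] show thesis by simp
    next
      case nS: False
      have "\<not> (\<exists>S. S \<subseteq> g i \<and> Poly_Mapping.single \<delta> (1::'k) = face_monomial S)"
        using nS by (metis face_monomial_single keys_single one_neq_zero singleton_inject)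
      moreover have "Poly_Mapping.single \<delta> 1 \<in> (U_monomials m :: 'k mpoly set)"
        using True unfolding U_monomials_eq by blast
      ultimately have "varX i * Poly_Mapping.single \<delta> 1 \<in> gens"
        using i(1) unfolding gens_def gens_nonsubfaces_def by blast
      then have "Poly_Mapping.single \<alpha> 1 \<in> J" using J(2) by (auto simp: varX_mult_single \<delta>(1))
      with that(1) show thesis .
    qed
  next
    case False
    with \<delta>(2) \<alpha> obtain j where j: "j \<in> {1..n}" "Xvar j \<in> Poly_Mapping.keys \<delta>" by blast
    from keys_split[OF j(2)] obtain \<delta>' where \<delta>': "\<delta> = Poly_Mapping.single (Xvar j) 1 + \<delta>'" "Poly_Mapping.keys \<delta>' \<subseteq> Poly_Mapping.keys \<delta>" .
    have "varX i * varX j \<in> J" using J(2) i j unfolding gens_def gens_squares_def by blast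
    then have "Poly_Mapping.single (Poly_Mapping.single (Xvar i) 1 + Poly_Mapping.single (Xvar j) 1) 1 \<in> J"
      by (simp add: varX_def mult_single)
    from J.I_single_add[OF this, of \<delta>'] \<delta> \<delta>' \<alpha> have "Poly_Mapping.single \<alpha> 1 \<in> J"
      by (simp add: add.assoc)
    with that(1) show thesis .
  qed
qed

lemma binomial_in_gens:
  assumes "i \<in> {1..n}" "j \<in> {1..n}" "S \<subseteq> g i" "S \<subseteq> g j"
  shows "varX i * face_monomial (g i - S) - varX j * face_monomial (g j - S) \<in> gens"
proof -
  have split: "face_monomial (g l) = face_monomial (g l - S) * (face_monomial S :: 'k mpoly)"
    if "l \<in> {1..n}" "S \<subseteq> g l" for l
    using face_exp_Un_disjoint[OF g_finite[OF that(1)] that(2)]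
    by (simp add: face_monomial_single[of "g l"] face_monomial_single[of S] face_monomial_single[of "g l - S"] mult_single)
  have U: "face_monomial (g l - S) \<in> (U_monomials m :: 'k mpoly set)" if "l \<in> {1..n}" for l
    using face_sub[OF g_face[OF that]] by (intro face_monomial_U_monomials) blast
  have "varX i * face_monomial (g i - S) - varX j * face_monomial (g j - S) \<in> (gens_binomials n m g :: 'k mpoly set)"
    unfolding gens_binomials_def
    by (rule CollectI, rule exI[of _ i], rule exI[of _ j], rule exI[of _ "face_monomial (g i - S)"],
        rule exI[of _ "face_monomial (g j - S)"], rule exI[of _ S]) (intro conjI refl assms split U Int_greatest)
  then show ?thesis unfolding gens_def by (rule UnI2)
qed

text \<open>Reduction to normal form: modulo the generated ideal every \<open>p\<close> equals the
  combination of standard monomials given by its coordinates, which is zero for \<open>p\<close> in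
  the annihilator.\<close>

lemma genideal_gens: "I = Idl\<^bsub>R\<^esub> gens"
proof
  interpret R: cring R by (rule poly_ring_cring)
  have gR: "gens \<subseteq> carrier R" using gens_sub sub by blast
  let ?J = "Idl\<^bsub>R\<^esub> gens"
  show JI: "?J \<subseteq> I" by (rule R.genideal_minimal[OF ideal gens_sub])
  interpret J: poly_ideal n m ?J
    by (rule poly_ideal.intro) (rule R.genideal_ideal[OF gR])
  have gJ: "gens \<subseteq> ?J" by (rule R.genideal_self[OF gR])
  interpret W: quot_coords n m I "carrier R" T std coord by (rule coords_all)
  \<comment> \<open>The normal form. It is linear, so the congruence only has to be checked on
    monomials.\<close>
  define N where "N p = (\<Sum>t\<in>T. const (coord t p) * std t)" for p
  have N_add: "N (p + q) = N p + N q" and N_const: "N (const c * p) = const c * N p" for p q c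
    by (simp_all add: N_def coord_add coord_const const_add const_mult sum.distrib distrib_right sum_distrib_left mult.assoc)
  have N_0: "N 0 = 0" by (simp add: N_def coord_0)
  have N_sum: "N (\<Sum>i\<in>S. p i) = (\<Sum>i\<in>S. N (p i))" for S and p :: "(var \<Rightarrow>\<^sub>0 nat) \<Rightarrow> _"
    by (induction S rule: infinite_finite_induct) (simp_all add: N_0 N_add)
  have N_rep: "N p = std t" if "t \<in> T" "represents t p" for t p
  proof -
    have "N p = (\<Sum>s\<in>T. if s = t then std t else 0)"
      unfolding N_def using that by (intro sum.cong) (auto simp: coord_represents)
    then show ?thesis using that(1) T_finite by simp
  qed
  have mono: "Poly_Mapping.single \<alpha> 1 - N (Poly_Mapping.single \<alpha> 1) \<in> ?J"
    if \<alpha>: "Poly_Mapping.keys \<alpha> \<subseteq> Xvar ` {1..n} \<union> Uvar ` {1..m}" for \<alpha>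
  proof (rule monomial_cases[OF J.poly_ideal_axioms gJ \<alpha>])
    assume J: "Poly_Mapping.single \<alpha> 1 \<in> ?J"
    then have "\<forall>t\<in>T. coord t (Poly_Mapping.single \<alpha> 1) = 0"
      using JI J.sub mem_Ann_iff by blast
    then have "N (Poly_Mapping.single \<alpha> 1) = 0" by (simp add: N_def)
    with J show ?thesis by simp
  next
    fix F assume F: "F \<in> \<Delta>" "\<alpha> = face_exp F"
    then have "N (Poly_Mapping.single \<alpha> 1) = std (Inl F)"
      using represents_face_monomial[of F] by (intro N_rep) (auto simp: T_def face_monomial_single)
    then show ?thesis using F J.I_0 by (simp add: std_Inl face_monomial_single)
  next
    fix i G assume i: "i \<in> {1..n}" and G: "G \<subseteq> g i" and \<alpha>: "\<alpha> = cone_exp i (g i - G)"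
    have G\<Delta>: "G \<in> \<Delta>" using subface[OF g_face[OF i] G] .
    have "N (Poly_Mapping.single \<alpha> 1) = std (Inr G)"
      using represents_complement[OF i G] G\<Delta> by (intro N_rep) (auto simp: T_def \<alpha> varX_face_monomial)
    \<comment> \<open>The facet chosen in \<open>std\<close> may differ from \<open>g i\<close>; the
      two representatives of \<open>G\<close> then differ by a binomial generator.\<close>
    moreover obtain j where "j \<in> {1..n}" "G \<subseteq> g j" "std (Inr G) = varX j * face_monomial (g j - G)"
      using std_Inr[OF G\<Delta>] .
    ultimately show ?thesis
      using binomial_in_gens[OF i _ G] gJ by (auto simp: \<alpha> varX_face_monomial)
  qed
  show "I \<subseteq> ?J"
  proof
    fix p assume p: "p \<in> I"
    have pR: "p \<in> carrier R" using sub[OF p] .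
    let ?m = "\<lambda>\<alpha>. Poly_Mapping.single \<alpha> (1::'k)"
    have ps: "p = (\<Sum>\<alpha>\<in>Poly_Mapping.keys p. const (Poly_Mapping.lookup p \<alpha>) * ?m \<alpha>)"
      by (subst mpoly_as_sum[of p]) (simp add: const_def mult_single)
    have "p - N p = (\<Sum>\<alpha>\<in>Poly_Mapping.keys p. const (Poly_Mapping.lookup p \<alpha>) * (?m \<alpha> - N (?m \<alpha>)))"
      by (subst (1 2) ps) (simp only: N_sum N_const right_diff_distrib sum_subtractf)
    also have "\<dots> \<in> ?J"
      using pR mono by (intro J.I_sum J.I_mult poly_ring_const) (auto simp: in_poly_ring_iff)
    finally have "p - N p \<in> ?J" .
    moreover have "N p = 0" using p pR mem_Ann_iff by (simp add: N_def)
    ultimately show "p \<in> ?J" by simp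
  qed
qed

end

section \<open>Assembly of the five statements about the algebra of the complex\<close>

theorem theorem3p2:
  fixes \<Delta> :: "nat set set" and n m d :: nat and g :: "nat \<Rightarrow> nat set"
    and f :: "'k::field_char_0 mpoly" and I :: "'k mpoly set"
    and e :: "nat \<Rightarrow> nat"
    and A :: "('k, 'k mpoly set) module"
    and Abi :: "int \<Rightarrow> int \<Rightarrow> ('k, 'k mpoly set) module"
    and Atot :: "int \<Rightarrow> ('k, 'k mpoly set) module"
    and cls :: "'k mpoly \<Rightarrow> 'k mpoly set"
  assumes "simplicial_complex {1..m} \<Delta>"
    and "\<Delta> \<noteq> {}"
    and "\<forall>j\<in>{1..m}. {j} \<in> \<Delta>"
    and "homogeneous_complex \<Delta> (int d - 2)"
    and "bij_betw g {1..n} (facets \<Delta>)"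
    and "f = facet_poly n g"
    and "I = Ann n m f"
    and "I \<inter> hom_part n m 1 = {0}"
    and "e = face_number \<Delta>"
    and "A = quot_algebra n m I"
    and "Abi = bigraded_piece n m I"
    and "Atot = graded_piece n m I"
    and "cls = quot_class n m I"
  shows
    \<comment> \<open>(1)\<close>
    "(internal_direct_sum A {..d} (\<lambda>k. carrier (Atot (int k)))
      \<and> (\<forall>k>d. carrier (Atot (int k)) = {\<zero>\<^bsub>A\<^esub>})
      \<and> (\<forall>k\<le>d. carrier (Atot (int k)) =
                 carrier (Abi 0 (int k)) <+>\<^bsub>A\<^esub> carrier (Abi 1 (int k - 1))
               \<and> carrier (Abi 0 (int k)) \<inter> carrier (Abi 1 (int k - 1)) = {\<zero>\<^bsub>A\<^esub>}))
    \<comment> \<open>(2)\<close>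
    \<and> (\<forall>k::nat.
        inj_on (\<lambda>F. cls (face_monomial F)) (faces_of_dim \<Delta> (int k - 1))
      \<and> vectorspace.basis class_ring (Abi 0 (int k))
          ((\<lambda>F. cls (face_monomial F)) ` faces_of_dim \<Delta> (int k - 1))
      \<and> vectorspace.dim class_ring (Abi 0 (int k)) = e k)
    \<comment> \<open>(3), duality: multiplication in \<open>A\<close> followed by evaluation at \<open>f\<close> is a perfect pairing\<close>
    \<and> (\<forall>k\<le>d. \<exists>\<Phi>. linear_iso (Abi 0 (int d - int k)) (dual_space (Abi 1 (int k - 1))) \<Phi>
        \<and> (\<forall>p\<in>bihom_part n m 0 (int d - int k). \<forall>q\<in>bihom_part n m 1 (int k - 1).
             const (\<Phi> (cls p) (cls q)) = act (p * q) f))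
    \<comment> \<open>(3), basis\<close>
    \<and> (\<forall>k\<le>d.
        (\<forall>F\<in>faces_of_dim \<Delta> (int d - int k - 1).
           \<exists>i\<in>{1..n}. \<exists>G\<in>U_monomials m. act (varX i * G) f = face_monomial F)
      \<and> (\<forall>i G. (\<forall>F\<in>faces_of_dim \<Delta> (int d - int k - 1).
                  i F \<in> {1..n} \<and> G F \<in> U_monomials m \<and> act (varX (i F) * G F) f = face_monomial F)
           \<longrightarrow> inj_on (\<lambda>F. cls (varX (i F) * G F)) (faces_of_dim \<Delta> (int d - int k - 1))
             \<and> vectorspace.basis class_ring (Abi 1 (int k - 1))
                 ((\<lambda>F. cls (varX (i F) * G F)) ` faces_of_dim \<Delta> (int d - int k - 1))))
    \<comment> \<open>(4)\<close>
    \<and> (\<forall>k\<le>d. vectorspace.dim class_ring (Atot (int k)) = e k + e (d - k))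
    \<comment> \<open>(5)\<close>
    \<and> I = Idl\<^bsub>poly_ring n m\<^esub> (gens_squares n m \<union> gens_nonfaces m \<Delta> I
                               \<union> gens_nonsubfaces n m g \<union> gens_binomials n m g)"
proof -
  interpret F: facet_complex n m d \<Delta> g f
    using assms(1,4-6) by unfold_locales
  note I = assms(7) and e = assms(9) and A = assms(10) and Abi = assms(11) and Atot = assms(12) and cls = assms(13)
  have 1: "internal_direct_sum A {..d} (\<lambda>k. carrier (Atot (int k)))
      \<and> (\<forall>k>d. carrier (Atot (int k)) = {\<zero>\<^bsub>A\<^esub>})
      \<and> (\<forall>k\<le>d. carrier (Atot (int k)) =
                 carrier (Abi 0 (int k)) <+>\<^bsub>A\<^esub> carrier (Abi 1 (int k - 1))
               \<and> carrier (Abi 0 (int k)) \<inter> carrier (Abi 1 (int k - 1)) = {\<zero>\<^bsub>A\<^esub>})"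
    unfolding I A Abi Atot
    by (intro conjI allI impI F.direct_sum F.total_above F.total_split)
  have 2: "inj_on (\<lambda>F. cls (face_monomial F)) (faces_of_dim \<Delta> (int k - 1))
      \<and> vectorspace.basis class_ring (Abi 0 (int k))
          ((\<lambda>F. cls (face_monomial F)) ` faces_of_dim \<Delta> (int k - 1))
      \<and> vectorspace.dim class_ring (Abi 0 (int k)) = e k" for k
  proof -
    interpret quot_coords n m F.I "bihom_part n m 0 (int k)" "faces_of_dim \<Delta> (int k - 1)" face_monomial "\<lambda>F. F.coord (Inl F)"
      by (rule F.coords_U)
    show ?thesis
      using inj_cls_b basis dim unfolding I Abi cls bigraded_piece_def e face_number_def by blast
  qed
  have 3: "\<exists>\<Phi>. linear_iso (Abi 0 (int d - int k)) (dual_space (Abi 1 (int k - 1))) \<Phi>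
        \<and> (\<forall>p\<in>bihom_part n m 0 (int d - int k). \<forall>q\<in>bihom_part n m 1 (int k - 1).
             const (\<Phi> (cls p) (cls q)) = act (p * q) f)" if "k \<le> d" for k
    unfolding I Abi cls by (rule F.duality[OF that])
  have 4: "\<exists>i\<in>{1..n}. \<exists>G\<in>U_monomials m. act (varX i * G) f = face_monomial F"
    if "F \<in> \<Delta>" for F
  proof -
    \<comment> \<open>The complement of \<open>F\<close> in any facet containing it supplies the
      required monomial.\<close>
    obtain i where "i \<in> {1..n}" "F \<subseteq> g i" using F.face_in_facet[OF \<open>F \<in> \<Delta>\<close>] by blast
    moreover from this have "act (varX i * face_monomial (g i - F)) f = face_monomial F"
      using F.act_single_cone_exp by (simp only: varX_face_monomial)
    moreover have "face_monomial (g i - F) \<in> (U_monomials m :: 'k mpoly set)"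
      using F.face_sub[OF F.g_face[OF \<open>i \<in> {1..n}\<close>]] by (intro F.face_monomial_U_monomials) blast
    ultimately show ?thesis by blast
  qed
  have 5: "inj_on (\<lambda>F. cls (varX (i F) * G F)) (faces_of_dim \<Delta> (int d - int k - 1))
             \<and> vectorspace.basis class_ring (Abi 1 (int k - 1))
                 ((\<lambda>F. cls (varX (i F) * G F)) ` faces_of_dim \<Delta> (int d - int k - 1))"
    if k: "k \<le> d" and iG: "\<forall>F\<in>faces_of_dim \<Delta> (int d - int k - 1).
                  i F \<in> {1..n} \<and> G F \<in> U_monomials m \<and> act (varX (i F) * G F) f = face_monomial F" for k i G
  proof -
    \<comment> \<open>The condition on the chosen monomials is exactly \<open>represents\<close>, so
      coordinates are available for an arbitrary choice.\<close>
    have rep: "F.represents (Inr F) (varX (i F) * G F)" if "F \<in> faces_of_dim \<Delta> (int d - int k - 1)" for F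
      using bspec[OF iG that] unfolding F.represents_def sum.case by blast
    interpret quot_coords n m F.I "bihom_part n m 1 (int k - 1)" "faces_of_dim \<Delta> (int d - int k - 1)"
      "\<lambda>F. varX (i F) * G F" "\<lambda>F. F.coord (Inr F)"
      by (rule F.coords_X[OF k]) (rule rep)
    show ?thesis
      using inj_cls_b basis unfolding I Abi cls bigraded_piece_def by blast
  qed
  have 6: "vectorspace.dim class_ring (Atot (int k)) = e k + e (d - k)" if "k \<le> d" for k
    unfolding I Atot e by (rule F.dim_total[OF that])
  have 7: "I = Idl\<^bsub>poly_ring n m\<^esub> (gens_squares n m \<union> gens_nonfaces m \<Delta> I
                               \<union> gens_nonsubfaces n m g \<union> gens_binomials n m g)"
    using F.genideal_gens unfolding F.gens_def I .
  have mem: "F \<in> \<Delta>" if "F \<in> faces_of_dim \<Delta> j" for F j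
    using that by (simp add: faces_of_dim_def)
  show ?thesis
    by (rule conjI[OF 1], rule conjI, rule allI, rule 2, rule conjI, intro allI impI, erule 3,
        rule conjI, intro allI impI, rule conjI, rule ballI, rule 4, erule mem,
        intro allI impI, erule (1) 5, rule conjI[OF _ 7], intro allI impI, erule 6)
qed

end
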